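(* Let $T>0$, $s\in[0,T]$, $x\in\mathbb R$, $D_1,D_2\in\mathbb R$, and let $\hat\sigma,\widetilde\sigma,\hat\eta,\widetilde\eta$ be nonnegative constants with $\hat\sigma^2+\widetilde\sigma^2=1$ and $\hat\eta^2+\widetilde\eta^2=1$. Consider the partially observed control problem $V^*=\inf_{u\in\hat{\mathcal U}}J(u)$ described in the context. Suppose $\phi=(\phi_1,\phi_2,\phi_3)\in C^1([0,T],\mathbb R^3)$ solves the Riccati system $$\phi_1'=\phi_1^2,\qquad \phi_2'=\phi_2^2+2\phi_1\phi_2,\qquad \phi_3'=-\hat\sigma^2\phi_1,$$ $$\phi_1(T)=D_1,\quad \phi_2(T)=D_2,\quad \phi_3(T)=0.$$ Then the optimal strategy for this control problem is $$u_t^*=-\phi_1(t)\hat X_t^*-\phi_2(t)\,\mathbb E[\hat X_t^*],\qquad\forall t\in(s,T),$$ where $\hat X^*$ denotes the prediction process associated with $u^*$, and the value is $$V^*=\phi_1(s)(x^2+\hat\eta^2s)+\phi_2(s)x^2+\phi_3(s)+D_1\big(\widetilde\eta^2s+\widetilde\sigma^2(T-s)\big).$$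
   Context: $(\Omega,\mathcal F,\mathbb P,\mathbb F)$ is a complete filtered probability space satisfying the usual conditions and carrying two independent real Brownian motions $\hat W$ and $\widetilde W$ with generated filtrations $\mathbb F^{\hat W}=(\mathcal F_t^{\hat W})_{0\le t\le T}$ and $\mathbb F^{\widetilde W}=(\mathcal F_t^{\widetilde W})_{0\le t\le T}$; it is assumed that $\mathbb F=\mathbb F^{\hat W}\times\mathbb F^{\widetilde W}$ and $\mathcal F=\mathcal F_T^{\hat W}\times\mathcal F_T^{\widetilde W}$ (i.e. $\mathbb F$ is the filtration generated jointly by the two Brownian motions). $L^2_{\mathbb F}$ is the set of $\mathbb F$-progressively measurable $u:[0,T]\times\Omega\to\mathbb R$ with $\mathbb E\big[\int_0^T|u_r|^2\,dr\big]<\infty$. The state, for $t\in[s,T]$, is $$X_t=X_s+\int_s^tu_r\,dr+\int_s^t\hat\sigma\,d\hat W_r+\int_s^t\widetilde\sigma\,d\widetilde W_r,\qquad X_s=x+\hat\eta\hat W_s+\widetilde\eta\widetilde W_s.$$ $\mu_t$ is the law of $X_t$, $[\mu]_m:=\int_{\mathbb R}y^m\,\mu(dy)$, and the cost is $$J(u)=\mathbb E\Big[\int_s^Tu_r^2\,dr\Big]+D_1[\mu_T]_2+D_2[\mu_T]_1^2.$$ The prediction process is $\hat X_t=\mathbb E[X_t\mid\mathcal F_t^{\hat W}]$, and $\hat\mu_t$ is its law. It can be written as $$\hat X_t=x+\hat\eta\hat W_s+\int_s^tu_r\,dr+\int_s^t\hat\sigma\,d\hat W_r.$$ Admissible controls: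 $\hat{\mathcal U}$ is the set of $u\in L^2_{\mathbb F}$ which together with $(X,J)$ satisfy the state equation and the cost formula above and are of the form $u_t=a(t,\hat\mu_t,\hat X_t)$ for all $t\in[s,T]$, for some controller (real-valued function) $a$ of time, law and predicted state. *)

theory Defs
  imports "HOL-Probability.Probability"
begin

text \<open>
  Processes are functions of type \<^typ>\<open>real \<Rightarrow> 'a \<Rightarrow> real\<close> (time first); only their values at
  times in \<open>[0, T]\<close> matter.  Of a \<sigma>-algebra \<open>F t\<close> in a filtration only its space and its sets
  matter.
\<close>

text \<open>
  The filtration generated by a process is augmented by the null sets of the underlying
  probability space, so that the usual conditions can hold.
\<close>

definition generated_filtration :: "'a measure \<Rightarrow> (real \<Rightarrow> 'a \<Rightarrow> real) \<Rightarrow> real \<Rightarrow> 'a measure" where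
  "generated_filtration M W t =
     sigma (space M)
       ({W r -` B \<inter> space M | r B. 0 \<le> r \<and> r \<le> t \<and> B \<in> sets borel} \<union> null_sets M)"

definition usual_conditions :: "'a measure \<Rightarrow> (real \<Rightarrow> 'a measure) \<Rightarrow> real \<Rightarrow> bool" where
  "usual_conditions M F T \<longleftrightarrow>
     complete_measure M \<and>
     (\<forall>t\<in>{0..T}. subalgebra M (F t)) \<and>
     (\<forall>r\<in>{0..T}. \<forall>t\<in>{r..T}. sets (F r) \<subseteq> sets (F t)) \<and>
     null_sets M \<subseteq> sets (F 0) \<and>
     (\<forall>t\<in>{0..<T}. sets (F t) = (\<Inter>r\<in>{t<..T}. sets (F r)))"

definition brownian_motion :: "'a measure \<Rightarrow> real \<Rightarrow> (real \<Rightarrow> 'a \<Rightarrow> real) \<Rightarrow> bool" where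
  "brownian_motion M T W \<longleftrightarrow>
     (\<forall>t\<in>{0..T}. W t \<in> borel_measurable M) \<and>
     (AE \<omega> in M. W 0 \<omega> = 0) \<and>
     (AE \<omega> in M. continuous_on {0..T} (\<lambda>t. W t \<omega>)) \<and>
     (\<forall>r t. 0 \<le> r \<longrightarrow> r < t \<longrightarrow> t \<le> T \<longrightarrow>
        distributed M lborel (\<lambda>\<omega>. W t \<omega> - W r \<omega>) (normal_density 0 (sqrt (t - r))) \<and>
        prob_space.indep_set M (sets (generated_filtration M W r))
          (sets (vimage_algebra (space M) (\<lambda>\<omega>. W t \<omega> - W r \<omega>) borel)))"

definition two_brownian_basis ::
  "'a measure \<Rightarrow> (real \<Rightarrow> 'a measure) \<Rightarrow> real \<Rightarrow> (real \<Rightarrow> 'a \<Rightarrow> real) \<Rightarrow> (real \<Rightarrow> 'a \<Rightarrow> real) \<Rightarrow> bool"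
where
  "two_brownian_basis M F T W V \<longleftrightarrow>
     prob_space M \<and> usual_conditions M F T \<and>
     brownian_motion M T W \<and> brownian_motion M T V \<and>
     prob_space.indep_set M (sets (generated_filtration M W T)) (sets (generated_filtration M V T)) \<and>
     (\<forall>t\<in>{0..T}. sets (F t) =
        sigma_sets (space M) (sets (generated_filtration M W t) \<union> sets (generated_filtration M V t))) \<and>
     sets M = sets (F T)"

definition progressively_measurable ::
  "'a measure \<Rightarrow> (real \<Rightarrow> 'a measure) \<Rightarrow> real \<Rightarrow> (real \<Rightarrow> 'a \<Rightarrow> real) \<Rightarrow> bool" where
  "progressively_measurable M F T u \<longleftrightarrow>
     (\<forall>t\<in>{0..T}. (\<lambda>(r, \<omega>). u r \<omega>) \<in> borel_measurable (restrict_space borel {0..t} \<Otimes>\<^sub>M F t))"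

definition L2_controls :: "'a measure \<Rightarrow> (real \<Rightarrow> 'a measure) \<Rightarrow> real \<Rightarrow> (real \<Rightarrow> 'a \<Rightarrow> real) set" where
  "L2_controls M F T =
     {u. progressively_measurable M F T u \<and>
         (\<integral>\<^sup>+\<omega>. (\<integral>\<^sup>+r\<in>{0..T}. ennreal ((u r \<omega>)\<^sup>2) \<partial>lborel) \<partial>M) < \<infinity>}"

text \<open>
  The stochastic integrals in the state equation have constant integrands, so they are the
  constants times Brownian increments.
\<close>

definition state ::
  "real \<Rightarrow> real \<Rightarrow> real \<Rightarrow> real \<Rightarrow> real \<Rightarrow> real \<Rightarrow> (real \<Rightarrow> 'a \<Rightarrow> real) \<Rightarrow> (real \<Rightarrow> 'a \<Rightarrow> real) \<Rightarrow>
   (real \<Rightarrow> 'a \<Rightarrow> real) \<Rightarrow> real \<Rightarrow> 'a \<Rightarrow> real"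
where
  "state s x \<eta>\<^sub>W \<eta>\<^sub>V \<sigma>\<^sub>W \<sigma>\<^sub>V W V u t \<omega> =
     x + \<eta>\<^sub>W * W s \<omega> + \<eta>\<^sub>V * V s \<omega> + (LINT r:{s..t}|lborel. u r \<omega>)
       + \<sigma>\<^sub>W * (W t \<omega> - W s \<omega>) + \<sigma>\<^sub>V * (V t \<omega> - V s \<omega>)"

definition law :: "'a measure \<Rightarrow> ('a \<Rightarrow> real) \<Rightarrow> real measure" where
  "law M Y = distr M borel Y"

definition moment :: "real measure \<Rightarrow> nat \<Rightarrow> real" where
  "moment \<mu> m = (LINT y|\<mu>. y ^ m)"

text \<open>Below, \<open>X\<close> is the map taking a control to its state process.\<close>

definition cost ::
  "'a measure \<Rightarrow> real \<Rightarrow> real \<Rightarrow> real \<Rightarrow> real \<Rightarrow> ((real \<Rightarrow> 'a \<Rightarrow> real) \<Rightarrow> real \<Rightarrow> 'a \<Rightarrow> real) \<Rightarrow>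
   (real \<Rightarrow> 'a \<Rightarrow> real) \<Rightarrow> real"
where
  "cost M s T D\<^sub>1 D\<^sub>2 X u =
     (LINT \<omega>|M. (LINT r:{s..T}|lborel. (u r \<omega>)\<^sup>2))
       + D\<^sub>1 * moment (law M (X u T)) 2 + D\<^sub>2 * (moment (law M (X u T)) 1)\<^sup>2"

definition prediction ::
  "'a measure \<Rightarrow> (real \<Rightarrow> 'a \<Rightarrow> real) \<Rightarrow> (real \<Rightarrow> 'a \<Rightarrow> real) \<Rightarrow> real \<Rightarrow> 'a \<Rightarrow> real" where
  "prediction M W Y t = real_cond_exp M (generated_filtration M W t) (Y t)"

text \<open>
  The controller is Borel in the predicted state, and arbitrary in time and law.  The feedback
  identity is almost sure at each time, as the prediction is only defined up to null sets.
\<close>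

definition admissible_controls ::
  "'a measure \<Rightarrow> (real \<Rightarrow> 'a measure) \<Rightarrow> real \<Rightarrow> real \<Rightarrow> (real \<Rightarrow> 'a \<Rightarrow> real) \<Rightarrow>
   ((real \<Rightarrow> 'a \<Rightarrow> real) \<Rightarrow> real \<Rightarrow> 'a \<Rightarrow> real) \<Rightarrow> (real \<Rightarrow> 'a \<Rightarrow> real) set"
where
  "admissible_controls M F s T W X =
     {u \<in> L2_controls M F T.
        \<exists>a :: real \<Rightarrow> real measure \<Rightarrow> real \<Rightarrow> real.
          (\<forall>t \<mu>. a t \<mu> \<in> borel_measurable borel) \<and>
          (\<forall>t\<in>{s..T}. AE \<omega> in M.
             u t \<omega> = a t (law M (prediction M W (X u) t)) (prediction M W (X u) t \<omega>))}"

definition optimal_in :: "'c set \<Rightarrow> ('c \<Rightarrow> real) \<Rightarrow> 'c \<Rightarrow> bool" where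
  "optimal_in U J u \<longleftrightarrow> u \<in> U \<and> (\<forall>v\<in>U. J u \<le> J v)"

definition riccati_solution ::
  "real \<Rightarrow> real \<Rightarrow> real \<Rightarrow> real \<Rightarrow> (real \<Rightarrow> real) \<Rightarrow> (real \<Rightarrow> real) \<Rightarrow> (real \<Rightarrow> real) \<Rightarrow> bool" where
  "riccati_solution T D\<^sub>1 D\<^sub>2 \<sigma>\<^sub>W \<phi>\<^sub>1 \<phi>\<^sub>2 \<phi>\<^sub>3 \<longleftrightarrow>
     (\<forall>t\<in>{0..T}.
        (\<phi>\<^sub>1 has_real_derivative (\<phi>\<^sub>1 t)\<^sup>2) (at t within {0..T}) \<and>
        (\<phi>\<^sub>2 has_real_derivative ((\<phi>\<^sub>2 t)\<^sup>2 + 2 * \<phi>\<^sub>1 t * \<phi>\<^sub>2 t)) (at t within {0..T}) \<and>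
        (\<phi>\<^sub>3 has_real_derivative (- \<sigma>\<^sub>W\<^sup>2 * \<phi>\<^sub>1 t)) (at t within {0..T})) \<and>
     \<phi>\<^sub>1 T = D\<^sub>1 \<and> \<phi>\<^sub>2 T = D\<^sub>2 \<and> \<phi>\<^sub>3 T = 0"

end

theory Submission
  imports Defs
begin

text \<open>
  Completing the square shows what an admissible control costs beyond the optimal value.  Write
  \<open>P\<close> for the part of the state that is driven by \<open>W\<close> and by the control.  The remaining part is
  driven by \<open>V\<close>, is centred and independent of \<open>W\<close>, and so enters the cost only through its
  variance, which no control can influence.  As the control is determined by \<open>W\<close>, the process
  \<open>P\<close> is the prediction of the state (\<open>prediction_eq\<close>), and

  \<open>J(u) = V* + \<integral> E [(u\<^sub>r + \<phi>\<^sub>1(r) P\<^sub>r + \<phi>\<^sub>2(r) E P\<^sub>r)\<^sup>2] dr\<close>  (\<open>cost_identity\<close>).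

  The integral is nonnegative, and it vanishes exactly if \<open>u\<close> follows the feedback law at almost
  every time.  It remains to find a control that follows the law (\<open>feedback\<close>), and this is a
  linear equation that can be solved path by path.

  For the identity, let \<open>m\<close> and \<open>e\<close> be the second moment and the mean of \<open>P\<close>.  Ito's formula
  suggests \<open>m' = \<sigma>\<^sub>W\<^sup>2 + 2 E [u P]\<close> and \<open>e' = E [u]\<close>, and with these the Riccati system is just
  what turns the derivative of \<open>\<phi>\<^sub>1 m + \<phi>\<^sub>2 e\<^sup>2 + \<phi>\<^sub>3\<close> into the expected square above minus
  \<open>E [u\<^sup>2]\<close>.  Since the diffusion coefficients are constant, no stochastic integration is needed:
  \<open>P\<close> is a Brownian combination plus the time integral of \<open>u\<close>, and \<open>m\<close> is computed by expanding
  the square.  The cross term is controlled by the independence of Brownian increments from the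
  past (\<open>noise_control_correlation\<close>), and the square of the time integral by Fubini's theorem.

  The moments are differentiable in time only almost everywhere, because the control is only square
  integrable.  The calculus is therefore that of absolutely continuous functions
  (\<open>primitive_on\<close>), for which the product rule again comes from Fubini's theorem
  (\<open>set_integral_triangle_product\<close>).
\<close>

section \<open>Square-integrable functions\<close>

definition square_integrable :: "'a measure \<Rightarrow> ('a \<Rightarrow> real) \<Rightarrow> bool" where
  "square_integrable M f \<longleftrightarrow> f \<in> borel_measurable M \<and> integrable M (\<lambda>x. (f x)\<^sup>2)"

lemma square_integrable_measurable: "square_integrable M f \<Longrightarrow> f \<in> borel_measurable M"
  by (simp add: square_integrable_def)

lemma square_integrable_mult:
  assumes "square_integrable M f" "square_integrable M g"
  shows "integrable M (\<lambda>x. f x * g x)"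
proof (rule Bochner_Integration.integrable_bound)
  have [measurable]: "f \<in> borel_measurable M" "g \<in> borel_measurable M"
    using assms by (auto simp: square_integrable_def)
  show "integrable M (\<lambda>x. (f x)\<^sup>2 + (g x)\<^sup>2)"
    using assms by (auto simp: square_integrable_def)
  show "(\<lambda>x. f x * g x) \<in> borel_measurable M" by measurable
  have "\<bar>a * b\<bar> \<le> a\<^sup>2 + b\<^sup>2" for a b :: real
  proof -
    have "0 \<le> (\<bar>a\<bar> - \<bar>b\<bar>)\<^sup>2" by simp
    then have "2 * (\<bar>a\<bar> * \<bar>b\<bar>) \<le> a\<^sup>2 + b\<^sup>2" by (simp add: power2_diff)
    moreover have "0 \<le> \<bar>a\<bar> * \<bar>b\<bar>" by simp
    ultimately have "\<bar>a\<bar> * \<bar>b\<bar> \<le> a\<^sup>2 + b\<^sup>2" by linarith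
    then show ?thesis by (simp add: abs_mult)
  qed
  then show "AE x in M. norm (f x * g x) \<le> norm ((f x)\<^sup>2 + (g x)\<^sup>2)"
    by simp
qed

lemma square_integrable_cmult:
  "square_integrable M f \<Longrightarrow> square_integrable M (\<lambda>x. c * f x)"
  by (auto simp: square_integrable_def power_mult_distrib)

lemma square_integrable_add:
  assumes "square_integrable M f" "square_integrable M g"
  shows "square_integrable M (\<lambda>x. f x + g x)"
proof -
  have "integrable M (\<lambda>x. (f x)\<^sup>2 + 2 * (f x * g x) + (g x)\<^sup>2)"
    using assms square_integrable_mult[OF assms]
    by (intro Bochner_Integration.integrable_add integrable_mult_right)
       (auto simp: square_integrable_def)
  then show ?thesis
    using assms by (auto simp: square_integrable_def power2_sum algebra_simps)
qed

lemma square_integrable_diff: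
  "square_integrable M f \<Longrightarrow> square_integrable M g \<Longrightarrow> square_integrable M (\<lambda>x. f x - g x)"
  using square_integrable_add[of M f "\<lambda>x. -1 * g x"] square_integrable_cmult[of M g "-1"] by simp

lemma (in finite_measure) square_integrable_const: "square_integrable M (\<lambda>x. c)"
  by (simp add: square_integrable_def)

lemma (in finite_measure) square_integrable_integrable:
  "square_integrable M f \<Longrightarrow> integrable M f"
  using square_integrable_mult[OF _ square_integrable_const[of 1]] by simp

lemma square_integrable_bounded_mult:
  assumes "square_integrable M f" "g \<in> borel_measurable M" "\<And>x. x \<in> space M \<Longrightarrow> \<bar>g x\<bar> \<le> B"
  shows "square_integrable M (\<lambda>x. g x * f x)"
  unfolding square_integrable_def
proof
  have [measurable]: "f \<in> borel_measurable M" "g \<in> borel_measurable M"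
    using assms by (auto simp: square_integrable_def)
  show "(\<lambda>x. g x * f x) \<in> borel_measurable M" by measurable
  show "integrable M (\<lambda>x. (g x * f x)\<^sup>2)"
  proof (rule Bochner_Integration.integrable_bound)
    show "integrable M (\<lambda>x. B\<^sup>2 * (f x)\<^sup>2)"
      using assms by (auto simp: square_integrable_def)
    show "AE x in M. norm ((g x * f x)\<^sup>2) \<le> norm (B\<^sup>2 * (f x)\<^sup>2)"
    proof (rule AE_I2)
      fix x assume "x \<in> space M"
      then have "\<bar>g x\<bar> \<le> B" by (rule assms)
      then have "(g x)\<^sup>2 \<le> B\<^sup>2" by (metis abs_ge_zero power2_abs power_mono)
      then show "norm ((g x * f x)\<^sup>2) \<le> norm (B\<^sup>2 * (f x)\<^sup>2)"
        by (simp add: power_mult_distrib mult_right_mono)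
    qed
  qed measurable
qed

lemma (in finite_measure) integral_square_le:
  assumes "square_integrable M f"
  shows "(\<integral>x. f x \<partial>M)\<^sup>2 \<le> measure M (space M) * (\<integral>x. (f x)\<^sup>2 \<partial>M)"
proof -
  let ?m = "measure M (space M)" and ?I = "\<integral>x. f x \<partial>M"
  have f: "integrable M f" "integrable M (\<lambda>x. (f x)\<^sup>2)"
    using assms square_integrable_integrable[OF assms] by (auto simp: square_integrable_def)
  have "0 \<le> (\<integral>x. (?m * f x - ?I)\<^sup>2 \<partial>M)" by simp
  also have "\<dots> = (\<integral>x. ?m\<^sup>2 * (f x)\<^sup>2 - 2 * ?m * ?I * f x + ?I\<^sup>2 \<partial>M)"
    by (simp add: power2_diff power_mult_distrib algebra_simps)
  also have "\<dots> = ?m\<^sup>2 * (\<integral>x. (f x)\<^sup>2 \<partial>M) - 2 * ?m * ?I * ?I + ?I\<^sup>2 * ?m"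
    using f by simp
  also have "\<dots> = ?m * (?m * (\<integral>x. (f x)\<^sup>2 \<partial>M) - ?I\<^sup>2)"
    by (simp add: power2_eq_square algebra_simps)
  finally have *: "0 \<le> ?m * (?m * (\<integral>x. (f x)\<^sup>2 \<partial>M) - ?I\<^sup>2)" .
  show ?thesis
  proof (cases "?m = 0")
    case True
    then have "AE x in M. f x = 0"
      by (intro emeasure_0_AE) (simp add: emeasure_eq_measure)
    then have "?I = 0" by (simp add: integral_eq_zero_AE)
    then show ?thesis using True by simp
  next
    case False
    then have "?m > 0" using measure_nonneg[of M "space M"] by linarith
    then show ?thesis using * by (simp add: zero_le_mult_iff)
  qed
qed

section \<open>Absolutely continuous functions and linear equations\<close>

text \<open>
  Fubini's theorem on the square \<open>{a..b} \<times> {a..b}\<close>, split along its diagonal, which is a null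
  set.  This is integration by parts for integrands that are merely integrable.
\<close>

lemma set_integral_triangle_product:
  fixes f g :: "real \<Rightarrow> real"
  assumes f: "set_integrable lborel {a..b} f" and g: "set_integrable lborel {a..b} g"
  shows "set_integrable lborel {a..b} (\<lambda>r. f r * (LINT q:{a..r}|lborel. g q))" (is ?i)
    and "(LINT r:{a..b}|lborel. f r) * (LINT r:{a..b}|lborel. g r) =
      (LINT r:{a..b}|lborel. f r * (LINT q:{a..r}|lborel. g q)) +
      (LINT r:{a..b}|lborel. g r * (LINT q:{a..r}|lborel. f q))" (is ?e)
proof -
  define f' g' where "f' = (\<lambda>r. indicator {a..b} r * f r)" "g' = (\<lambda>r. indicator {a..b} r * g r)"
  have int: "integrable lborel f'" "integrable lborel g'"
    using f g by (auto simp: set_integrable_def f'_g'_def)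
  have [measurable]: "f' \<in> borel_measurable borel" "g' \<in> borel_measurable borel"
    using borel_measurable_integrable[OF int(1)] borel_measurable_integrable[OF int(2)] by auto
  let ?K = "\<lambda>(r, q). f' r * g' q"
  let ?K1 = "\<lambda>(r, q). f' r * g' q * indicator {..r} q"
  let ?K2 = "\<lambda>(r, q). f' r * g' q * indicator {..q} r"
  have K: "integrable (lborel \<Otimes>\<^sub>M lborel) ?K"
    by (rule lborel_pair.Fubini_integrable) (use int in \<open>auto simp: abs_mult\<close>)
  have [measurable]: "(\<lambda>x. f' (fst x) * g' (snd x) * indicator {..fst x} (snd x)) \<in> borel_measurable (borel \<Otimes>\<^sub>M borel)"
      "(\<lambda>x. f' (fst x) * g' (snd x) * indicator {..snd x} (fst x)) \<in> borel_measurable (borel \<Otimes>\<^sub>M borel)"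
    by (simp_all add: atMost_def indicator_def)
  have K1: "integrable (lborel \<Otimes>\<^sub>M lborel) ?K1"
    by (rule Bochner_Integration.integrable_bound[OF K])
       (auto simp: split_beta' indicator_def)
  have K2: "integrable (lborel \<Otimes>\<^sub>M lborel) ?K2"
    by (rule Bochner_Integration.integrable_bound[OF K])
       (auto simp: split_beta' indicator_def)
  have in1: "(\<integral>q. h q * indicator {..r} q \<partial>lborel) = (LINT q:{a..r}|lborel. k q)"
    if "r \<in> {a..b}" "h = (\<lambda>r. indicator {a..b} r * k r)" for h k :: "real \<Rightarrow> real" and r
    unfolding set_lebesgue_integral_def
    by (rule Bochner_Integration.integral_cong) (use that in \<open>auto simp: indicator_def\<close>)
  have I1: "f' r * (\<integral>q. g' q * indicator {..r} q \<partial>lborel) =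
      indicator {a..b} r *\<^sub>R (f r * (LINT q:{a..r}|lborel. g q))" for r
    by (cases "r \<in> {a..b}") (simp_all add: in1[OF _ f'_g'_def(2)] f'_g'_def(1))
  have I2: "g' r * (\<integral>q. f' q * indicator {..r} q \<partial>lborel) =
      indicator {a..b} r *\<^sub>R (g r * (LINT q:{a..r}|lborel. f q))" for r
    by (cases "r \<in> {a..b}") (simp_all add: in1[OF _ f'_g'_def(1)] f'_g'_def(2))
  have "integrable lborel (\<lambda>r. \<integral>q. f' r * g' q * indicator {..r} q \<partial>lborel)"
    using lborel_pair.integrable_fst[OF K1] by simp
  also have "(\<lambda>r. \<integral>q. f' r * g' q * indicator {..r} q \<partial>lborel) =
      (\<lambda>r. indicator {a..b} r *\<^sub>R (f r * (LINT q:{a..r}|lborel. g q)))"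
    by (simp add: mult.assoc I1)
  finally show ?i by (simp add: set_integrable_def)
  have "(LINT r:{a..b}|lborel. f r) * (LINT r:{a..b}|lborel. g r) = (\<integral>r. f' r * (\<integral>q. g' q \<partial>lborel) \<partial>lborel)"
    by (simp add: set_lebesgue_integral_def f'_g'_def)
  also have "\<dots> = integral\<^sup>L (lborel \<Otimes>\<^sub>M lborel) ?K"
    using lborel_pair.integral_fst[OF K] by simp
  also have "\<dots> = integral\<^sup>L (lborel \<Otimes>\<^sub>M lborel) (\<lambda>z. ?K1 z + ?K2 z)"
  proof (rule integral_cong_AE)
    have "AE z in lborel \<Otimes>\<^sub>M lborel. fst z \<noteq> (snd z :: real)"
    proof (rule lborel_pair.AE_pair_measure)
      show "{x \<in> space (lborel \<Otimes>\<^sub>M lborel). fst x \<noteq> (snd x :: real)} \<in> sets (lborel \<Otimes>\<^sub>M lborel)"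
        by measurable
      show "AE x in lborel. AE y in lborel. fst (x, y) \<noteq> (snd (x, y) :: real)"
        using AE_lborel_singleton by (auto simp: eq_commute)
    qed
    then show "AE z in lborel \<Otimes>\<^sub>M lborel. ?K z = ?K1 z + ?K2 z"
      by eventually_elim (auto simp: indicator_def)
  qed (simp_all add: split_beta')
  also have "\<dots> = integral\<^sup>L (lborel \<Otimes>\<^sub>M lborel) ?K1 + integral\<^sup>L (lborel \<Otimes>\<^sub>M lborel) ?K2"
    by (rule Bochner_Integration.integral_add[OF K1 K2])
  also have "integral\<^sup>L (lborel \<Otimes>\<^sub>M lborel) ?K1 = (LINT r:{a..b}|lborel. f r * (LINT q:{a..r}|lborel. g q))"
    using lborel_pair.integral_fst[OF K1] by (simp add: mult.assoc I1 set_lebesgue_integral_def)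
  also have "integral\<^sup>L (lborel \<Otimes>\<^sub>M lborel) ?K2 = (\<integral>q. (\<integral>r. f' r * g' q * indicator {..q} r \<partial>lborel) \<partial>lborel)"
    using lborel_pair.integral_snd[OF K2] by simp
  also have "\<dots> = (\<integral>q. (\<integral>r. g' q * (f' r * indicator {..q} r) \<partial>lborel) \<partial>lborel)"
    by (simp add: mult_ac)
  also have "\<dots> = (\<integral>q. g' q * (\<integral>r. f' r * indicator {..q} r \<partial>lborel) \<partial>lborel)"
    by simp
  also have "\<dots> = (LINT r:{a..b}|lborel. g r * (LINT q:{a..r}|lborel. f q))"
    by (simp add: I2 set_lebesgue_integral_def)
  finally show ?e .
qed

text \<open>
  Absolute continuity with density \<open>f\<close>, in integral form: at a given time \<open>f\<close> need not be the
  derivative of \<open>F\<close>.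
\<close>

definition primitive_on :: "real \<Rightarrow> real \<Rightarrow> (real \<Rightarrow> real) \<Rightarrow> (real \<Rightarrow> real) \<Rightarrow> bool" where
  "primitive_on a b F f \<longleftrightarrow> set_integrable lborel {a..b} f \<and>
     (\<forall>t\<in>{a..b}. F t = F a + (LINT r:{a..t}|lborel. f r))"

lemma set_integrable_initial:
  "set_integrable lborel {a..b} f \<Longrightarrow> t \<le> b \<Longrightarrow> set_integrable lborel {a..t} f" for f :: "real \<Rightarrow> real"
  by (rule set_integrable_subset) auto

lemma primitive_on_cong:
  assumes "primitive_on a b F f" and fg: "\<And>t. t \<in> {a..b} \<Longrightarrow> f t = g t"
  shows "primitive_on a b F g"
proof -
  have "set_integrable lborel {a..b} g \<longleftrightarrow> set_integrable lborel {a..b} f"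
    by (rule set_integrable_cong) (use fg in auto)
  moreover have "(LINT r:{a..t}|lborel. g r) = (LINT r:{a..t}|lborel. f r)" if "t \<in> {a..b}" for t
    by (rule set_lebesgue_integral_cong) (use fg that in auto)
  ultimately show ?thesis using assms(1) unfolding primitive_on_def by metis
qed

lemma primitive_on_const_mult:
  "primitive_on a b F f \<Longrightarrow> primitive_on a b (\<lambda>t. c * F t) (\<lambda>t. c * f t)"
  unfolding primitive_on_def by (metis distrib_left set_integral_mult_right set_integrable_mult_right)

lemma primitive_on_add:
  assumes "primitive_on a b F f" "primitive_on a b G g"
  shows "primitive_on a b (\<lambda>t. F t + G t) (\<lambda>t. f t + g t)"
  unfolding primitive_on_def
proof (intro conjI ballI)
  have f: "set_integrable lborel {a..b} f" and g: "set_integrable lborel {a..b} g"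
    using assms unfolding primitive_on_def by blast+
  then show "set_integrable lborel {a..b} (\<lambda>t. f t + g t)" by (rule set_integral_add(1))
  fix t assume t: "t \<in> {a..b}"
  then have "(LINT r:{a..t}|lborel. f r + g r) = (LINT r:{a..t}|lborel. f r) + (LINT r:{a..t}|lborel. g r)"
    by (intro set_integral_add(2) set_integrable_initial[OF f] set_integrable_initial[OF g]) auto
  moreover have "F t = F a + (LINT r:{a..t}|lborel. f r)" "G t = G a + (LINT r:{a..t}|lborel. g r)"
    using assms t unfolding primitive_on_def by blast+
  ultimately show "F t + G t = F a + G a + (LINT r:{a..t}|lborel. f r + g r)"
    by linarith
qed

lemma primitive_on_mult:
  assumes "primitive_on a b F f" "primitive_on a b G g"
  shows "primitive_on a b (\<lambda>t. F t * G t) (\<lambda>t. f t * G t + F t * g t)"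
proof -
  let ?F = "\<lambda>t. LINT r:{a..t}|lborel. f r" and ?G = "\<lambda>t. LINT r:{a..t}|lborel. g r"
  have f: "set_integrable lborel {a..b} f" and g: "set_integrable lborel {a..b} g"
    and F: "\<And>t. t \<in> {a..b} \<Longrightarrow> F t = F a + ?F t" and G: "\<And>t. t \<in> {a..b} \<Longrightarrow> G t = G a + ?G t"
    using assms unfolding primitive_on_def by blast+
  let ?h = "\<lambda>t. G a * f t + F a * g t + (f t * ?G t + g t * ?F t)"
  have h: "f t * G t + F t * g t = ?h t" if "t \<in> {a..b}" for t
    using F[OF that] G[OF that] by (simp add: algebra_simps)
  have int: "set_integrable lborel {a..b} (\<lambda>t. G a * f t)" "set_integrable lborel {a..b} (\<lambda>t. F a * g t)"
     "set_integrable lborel {a..b} (\<lambda>t. f t * ?G t)" "set_integrable lborel {a..b} (\<lambda>t. g t * ?F t)"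
    using f g set_integral_triangle_product(1)[OF f g] set_integral_triangle_product(1)[OF g f] by auto
  then have "set_integrable lborel {a..b} ?h" by (intro set_integral_add(1))
  then have "set_integrable lborel {a..b} (\<lambda>t. f t * G t + F t * g t)"
    using h set_integrable_cong[of lborel lborel "{a..b}" "{a..b}" "\<lambda>t. f t * G t + F t * g t" ?h]
    by auto
  moreover have "F t * G t = F a * G a + (LINT r:{a..t}|lborel. f r * G r + F r * g r)"
    if t: "t \<in> {a..b}" for t
  proof -
    have ft: "set_integrable lborel {a..t} f" and gt: "set_integrable lborel {a..t} g"
      using set_integrable_initial[OF f] set_integrable_initial[OF g] t by auto
    have "(LINT r:{a..t}|lborel. f r * G r + F r * g r) = (LINT r:{a..t}|lborel. ?h r)"
      by (rule set_lebesgue_integral_cong) (use h t in auto)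
    also have "\<dots> = G a * ?F t + F a * ?G t + ?F t * ?G t"
      using ft gt set_integral_triangle_product(1)[OF ft gt] set_integral_triangle_product(1)[OF gt ft]
        set_integral_triangle_product(2)[OF ft gt]
      by (simp add: set_integral_add)
    finally show ?thesis using F[OF t] G[OF t] by (simp add: algebra_simps)
  qed
  ultimately show ?thesis unfolding primitive_on_def by blast
qed

lemma primitive_on_derivative:
  assumes "\<And>t. t \<in> {a..b} \<Longrightarrow> (F has_real_derivative f t) (at t within {a..b})"
    and "continuous_on {a..b} f"
  shows "primitive_on a b F f"
  unfolding primitive_on_def
proof (intro conjI ballI)
  show "set_integrable lborel {a..b} f"
    by (rule borel_integrable_atLeastAtMost') fact
  fix t assume t: "t \<in> {a..b}"
  have "(\<integral>r. indicator {a..t} r *\<^sub>R f r \<partial>lborel) = F t - F a"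
  proof (rule integral_FTC_atLeastAtMost)
    show "continuous_on {a..t} f" using assms(2) t by (auto elim: continuous_on_subset)
    fix r assume "a \<le> r" "r \<le> t"
    then have "(F has_real_derivative f r) (at r within {a..t})"
      using assms(1)[of r] t by (auto elim!: DERIV_subset)
    then show "(F has_vector_derivative f r) (at r within {a..t})"
      by (simp add: has_real_derivative_iff_has_vector_derivative)
  qed (use t in auto)
  then show "F t = F a + (LINT r:{a..t}|lborel. f r)" by (simp add: set_lebesgue_integral_def)
qed

lemma set_integral_has_real_derivative:
  fixes f :: "real \<Rightarrow> real"
  assumes f: "continuous_on {a..b} f" and F: "\<And>t. t \<in> {a..b} \<Longrightarrow> F t = c + (LINT r:{a..t}|lborel. f r)"
    and t: "t \<in> {a..b}"
  shows "(F has_real_derivative f t) (at t within {a..b})"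
proof -
  have "F r = c + integral {a..r} f" if "r \<in> {a..b}" for r
    using F[OF that] set_borel_integral_eq_integral(2)[of "{a..r}" f]
      borel_integrable_atLeastAtMost'[OF continuous_on_subset[OF f], of a r] that by auto
  moreover have "((\<lambda>r. c + integral {a..r} f) has_real_derivative f t) (at t within {a..b})"
    using integral_has_real_derivative[OF f t] by (auto intro!: derivative_eq_intros)
  ultimately show ?thesis
    using t by (auto intro: has_field_derivative_transform_within[where d=1])
qed

lemma primitive_on_imp_continuous:
  assumes "primitive_on a b F f"
  shows "continuous_on {a..b} F"
proof -
  have f: "set_integrable lborel {a..b} f" and F: "\<And>t. t \<in> {a..b} \<Longrightarrow> F t = F a + (LINT r:{a..t}|lborel. f r)"
    using assms unfolding primitive_on_def by blast+
  have "continuous_on {a..b} (\<lambda>t. F a + integral {a..t} f)"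
    by (intro continuous_intros indefinite_integral_continuous_1 set_borel_integral_eq_integral(1)[OF f])
  moreover have "F a + integral {a..t} f = F t" if "t \<in> {a..b}" for t
    using F[OF that] set_borel_integral_eq_integral(2)[OF set_integrable_initial[OF f]] that by simp
  ultimately show ?thesis by (rule continuous_on_eq)
qed

lemma set_integral_point: "(LINT r:{a}|lborel. f r) = 0" for f :: "real \<Rightarrow> real"
  unfolding set_lebesgue_integral_def
  by (rule integral_eq_zero_AE, rule AE_mp[OF AE_lborel_singleton[of a]]) (simp add: indicator_def)

lemma continuous_on_set_integral:
  fixes f :: "real \<Rightarrow> real"
  assumes "continuous_on {a..b} f"
  shows "continuous_on {a..b} (\<lambda>t. LINT r:{a..t}|lborel. f r)"
proof (rule primitive_on_imp_continuous)
  show "primitive_on a b (\<lambda>t. LINT r:{a..t}|lborel. f r) f"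
    unfolding primitive_on_def using borel_integrable_atLeastAtMost'[OF assms]
    by (simp add: set_integral_point)
qed

text \<open>
  The integrating factor \<open>exp P\<close> turns \<open>y' = g - p y\<close> into \<open>(exp P \<cdot> y)' = exp P \<cdot> g\<close>.
\<close>

lemma variation_of_constants:
  fixes g p :: "real \<Rightarrow> real"
  assumes p: "continuous_on {a..b} p" and g: "continuous_on {a..b} g" and t: "t \<in> {a..b}"
  defines "P \<equiv> \<lambda>t. LINT r:{a..t}|lborel. p r"
  defines "y \<equiv> \<lambda>t. exp (- P t) * (LINT r:{a..t}|lborel. exp (P r) * g r)"
  shows "y t = (LINT r:{a..t}|lborel. g r - p r * y r)"
proof -
  let ?Q = "\<lambda>t. LINT r:{a..t}|lborel. exp (P r) * g r"
  have P: "(P has_real_derivative p r) (at r within {a..b})" if "r \<in> {a..b}" for r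
    using set_integral_has_real_derivative[OF p, of P 0 r] that by (simp add: P_def)
  have contP: "continuous_on {a..b} P" unfolding P_def by (rule continuous_on_set_integral[OF p])
  have contQ': "continuous_on {a..b} (\<lambda>r. exp (P r) * g r)"
    by (intro continuous_intros contP g)
  have Q: "(?Q has_real_derivative exp (P r) * g r) (at r within {a..b})" if "r \<in> {a..b}" for r
    using set_integral_has_real_derivative[OF contQ', of ?Q 0 r] that by simp
  have conty: "continuous_on {a..b} y"
    unfolding y_def by (intro continuous_intros contP continuous_on_set_integral contQ')
  have y: "(y has_real_derivative g r - p r * y r) (at r within {a..b})" if "r \<in> {a..b}" for r
  proof -
    have "(y has_real_derivative exp (- P r) * (exp (P r) * g r) + exp (- P r) * - p r * ?Q r) (at r within {a..b})"
      unfolding y_def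
      by (rule derivative_eq_intros P[OF that] Q[OF that] refl)+ (simp add: algebra_simps)
    moreover have "exp (- P r) * (exp (P r) * g r) + exp (- P r) * - p r * ?Q r = g r - p r * y r"
      by (simp add: y_def exp_minus)
    ultimately show ?thesis by simp
  qed
  have "primitive_on a b y (\<lambda>r. g r - p r * y r)"
    by (rule primitive_on_derivative[OF y]) (assumption | intro continuous_intros g p conty)+
  then have "y t = y a + (LINT r:{a..t}|lborel. g r - p r * y r)"
    using t unfolding primitive_on_def by blast
  moreover have "y a = 0" by (simp add: y_def set_integral_point)
  ultimately show ?thesis by simp
qed

text \<open>
  The product \<open>exp P \<cdot> d\<close> with the integrating factor has density zero, hence is constant.
\<close>

lemma linear_ode_unique:
  assumes p: "continuous_on {a..b} p" and d: "primitive_on a b d (\<lambda>t. - p t * d t)"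
    and "d a = 0" and t: "t \<in> {a..b}"
  shows "d t = 0"
proof -
  let ?P = "\<lambda>t. LINT r:{a..t}|lborel. p r"
  have P: "(?P has_real_derivative p r) (at r within {a..b})" if "r \<in> {a..b}" for r
    using set_integral_has_real_derivative[OF p, of ?P 0 r] that by simp
  have "primitive_on a b (\<lambda>t. exp (?P t)) (\<lambda>t. exp (?P t) * p t)"
  proof (rule primitive_on_derivative)
    show "((\<lambda>t. exp (?P t)) has_real_derivative exp (?P r) * p r) (at r within {a..b})"
      if "r \<in> {a..b}" for r
      by (rule derivative_eq_intros P[OF that] refl)+
    show "continuous_on {a..b} (\<lambda>t. exp (?P t) * p t)"
      by (intro continuous_intros continuous_on_set_integral p)
  qed
  from primitive_on_mult[OF this d]
  have "primitive_on a b (\<lambda>t. exp (?P t) * d t) (\<lambda>t. 0)" by simp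
  then have "exp (?P t) * d t = exp (?P a) * d a + (LINT r:{a..t}|lborel. 0)"
    using t unfolding primitive_on_def by blast
  then show ?thesis using \<open>d a = 0\<close> by (simp add: set_lebesgue_integral_def)
qed

section \<open>Measurability along continuous paths\<close>

text \<open>
  Continuity in time makes \<open>f\<close> the limit of its values at the grid points
  \<open>\<lfloor>(n + 1) r\<rfloor> / (n + 1)\<close>; for each \<open>n\<close> these take countably many values.
\<close>

lemma caratheodory_measurable:
  fixes f :: "real \<Rightarrow> 'a \<Rightarrow> real"
  assumes f: "\<And>r. r \<in> {0..t} \<Longrightarrow> f r \<in> borel_measurable G"
    and cont: "\<And>\<omega>. \<omega> \<in> space G \<Longrightarrow> continuous_on {0..t} (\<lambda>r. f r \<omega>)"
  shows "(\<lambda>(r, \<omega>). f r \<omega>) \<in> borel_measurable (restrict_space borel {0..t} \<Otimes>\<^sub>M G)"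
proof (rule borel_measurable_LIMSEQ_real)
  let ?B = "restrict_space borel {0..t} \<Otimes>\<^sub>M G"
  let ?r = "\<lambda>n r. real_of_int \<lfloor>real (Suc n) * r\<rfloor> / real (Suc n)"
  have r: "0 \<le> ?r n r" "?r n r \<le> r" "r - 1 / real (Suc n) \<le> ?r n r" if "0 \<le> r" for n r
  proof -
    obtain N where N: "real (Suc n) = N" "N > 0" by simp
    have "0 \<le> N * r" "real_of_int \<lfloor>N * r\<rfloor> \<le> N * r" "N * r - 1 \<le> real_of_int \<lfloor>N * r\<rfloor>"
      using that N(2) by (simp, linarith+)
    moreover have "r - 1 / N = (N * r - 1) / N" using N(2) by (simp add: field_simps)
    ultimately show "0 \<le> ?r n r" "?r n r \<le> r" "r - 1 / real (Suc n) \<le> ?r n r"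
      unfolding N(1) using N(2) by (simp_all add: divide_right_mono divide_le_eq mult.commute)
  qed
  have fst [measurable]: "fst \<in> borel_measurable ?B"
    using measurable_fst[of "restrict_space borel {0..t}" G]
    by (rule measurable_compose) (simp add: measurable_restrict_space1)
  (* Clipping to {0..t} changes no grid point that occurs, but it makes f measurable at every
     index of the countable family, also at those that are never used. *)
  show "(\<lambda>(r, \<omega>). f (max 0 (min t (?r n r))) \<omega>) \<in> borel_measurable ?B" for n
  proof (cases "0 \<le> t")
    case True
    have "(\<lambda>z. f (max 0 (min t (real_of_int \<lfloor>real (Suc n) * fst z\<rfloor> / real (Suc n)))) (snd z))
        \<in> borel_measurable ?B"
    proof (rule measurable_compose_countable[where f="\<lambda>k z. f (max 0 (min t (real_of_int k / real (Suc n)))) (snd z)"])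
      show "(\<lambda>z. f (max 0 (min t (real_of_int k / real (Suc n)))) (snd z)) \<in> borel_measurable ?B" for k
        using True by (intro measurable_compose[OF measurable_snd] f) auto
      show "(\<lambda>z. \<lfloor>real (Suc n) * fst z\<rfloor>) \<in> measurable ?B (count_space UNIV)"
        by measurable
    qed
    then show ?thesis by (simp add: split_beta')
  next
    case False
    then have "space ?B = {}" by (auto simp: space_pair_measure space_restrict_space)
    then show ?thesis by (simp add: measurable_def)
  qed
  fix z assume "z \<in> space ?B"
  then obtain r \<omega> where z: "z = (r, \<omega>)" "0 \<le> r" "r \<le> t" "\<omega> \<in> space G"
    by (auto simp: space_pair_measure space_restrict_space)
  have lim: "(\<lambda>n. ?r n r) \<longlonglongrightarrow> r"
  proof (rule tendsto_sandwich)
    have "(\<lambda>n. r - 1 / real (Suc n)) \<longlonglongrightarrow> r - 0"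
      by (intro tendsto_intros LIMSEQ_Suc lim_1_over_n)
    then show "(\<lambda>n. r - 1 / real (Suc n)) \<longlonglongrightarrow> r" by simp
  qed (use r[OF z(2)] in auto)
  have "(\<lambda>n. f (?r n r) \<omega>) \<longlonglongrightarrow> f r \<omega>"
    by (rule continuous_on_tendsto_compose[OF cont[OF z(4)] lim])
       (use z r[OF z(2)] order_trans[OF r(2)[OF z(2)] z(3)] in auto)
  moreover have "max 0 (min t (?r n r)) = ?r n r" for n
    using r(1,2)[OF z(2), of n] z(3) by linarith
  ultimately show "(\<lambda>n. (\<lambda>(r, \<omega>). f (max 0 (min t (?r n r))) \<omega>) z) \<longlonglongrightarrow> (\<lambda>(r, \<omega>). f r \<omega>) z"
    using z by simp
qed

text \<open>
  With \<open>G\<close> the information available at time \<open>t\<close>, this is why a control that is computed from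
  integrals along the observed path is adapted.
\<close>

lemma pathwise_integral_measurable:
  fixes f :: "real \<Rightarrow> 'a \<Rightarrow> real"
  assumes f: "\<And>q. q \<in> {0..t} \<Longrightarrow> f q \<in> borel_measurable G"
    and cont: "\<And>\<omega>. \<omega> \<in> space G \<Longrightarrow> continuous_on {0..t} (\<lambda>q. f q \<omega>)" and a: "0 \<le> a"
  shows "(\<lambda>\<omega>. LINT q:{a..t}|lborel. f q \<omega>) \<in> borel_measurable G"
proof -
  let ?R = "restrict_space lborel {0..t}"
  interpret R: finite_measure ?R
    by (rule finite_measureI)
       (cases "0 \<le> t", simp_all add: emeasure_restrict_space space_restrict_space)
  have [measurable]: "(\<lambda>z. f (fst z) (snd z)) \<in> borel_measurable (?R \<Otimes>\<^sub>M G)"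
    using caratheodory_measurable[OF f cont] by (simp add: split_beta' cong: measurable_cong_sets sets_pair_measure_cong sets_restrict_space_cong)
  have id [measurable]: "(\<lambda>r. r) \<in> borel_measurable ?R" by (simp add: measurable_restrict_space1)
  have "(\<lambda>\<omega>. \<integral>q. (if a \<le> q then 1 else 0) * f q \<omega> \<partial>?R) \<in> borel_measurable G"
  proof (rule R.borel_measurable_lebesgue_integral)
    have [measurable]: "(\<lambda>y. f (snd y) (fst y)) \<in> borel_measurable (G \<Otimes>\<^sub>M ?R)"
      by (rule measurable_compose[of "\<lambda>y. (snd y, fst y)" _ "?R \<Otimes>\<^sub>M G" "\<lambda>z. f (fst z) (snd z)", simplified])
         measurable
    have [measurable]: "(\<lambda>y. snd y) \<in> borel_measurable (G \<Otimes>\<^sub>M ?R)"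
      by (rule measurable_compose[OF _ id]) measurable
    show "(\<lambda>(\<omega>, q). (if a \<le> q then 1 else 0) * f q \<omega>) \<in> borel_measurable (G \<Otimes>\<^sub>M ?R)"
      unfolding split_beta' by measurable
  qed
  also have "(\<lambda>\<omega>. \<integral>q. (if a \<le> q then 1 else 0) * f q \<omega> \<partial>?R) = (\<lambda>\<omega>. LINT q:{a..t}|lborel. f q \<omega>)"
  proof
    fix \<omega>
    have "(\<integral>q. (if a \<le> q then 1 else 0) * f q \<omega> \<partial>?R) =
        (\<integral>q. indicator {0..t} q *\<^sub>R ((if a \<le> q then 1 else 0) * f q \<omega>) \<partial>lborel)"
      by (rule integral_restrict_space) simp
    also have "\<dots> = (LINT q:{a..t}|lborel. f q \<omega>)"
      unfolding set_lebesgue_integral_def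
      by (rule Bochner_Integration.integral_cong) (use a in \<open>auto simp: indicator_def\<close>)
    finally show "(\<integral>q. (if a \<le> q then 1 else 0) * f q \<omega> \<partial>?R) = (LINT q:{a..t}|lborel. f q \<omega>)" .
  qed
  finally show ?thesis .
qed

section \<open>Generated filtrations and Brownian increments\<close>

lemma space_generated_filtration [simp]: "space (generated_filtration M W t) = space M"
  by (simp add: generated_filtration_def space_measure_of_conv)

lemma sets_generated_filtration:
  "sets (generated_filtration M W t) = sigma_sets (space M)
     ({W r -` B \<inter> space M | r B. 0 \<le> r \<and> r \<le> t \<and> B \<in> sets borel} \<union> null_sets M)"
  unfolding generated_filtration_def
  by (rule sets_measure_of) (auto dest: sets.sets_into_space)

lemma null_sets_generated_filtration: "null_sets M \<subseteq> sets (generated_filtration M W t)"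
  unfolding sets_generated_filtration by auto

lemma generated_filtration_mono:
  assumes "r \<le> t"
  shows "sets (generated_filtration M W r) \<subseteq> sets (generated_filtration M W t)"
proof -
  have "{W q -` B \<inter> space M | q B. 0 \<le> q \<and> q \<le> r \<and> B \<in> sets borel} \<subseteq>
      {W q -` B \<inter> space M | q B. 0 \<le> q \<and> q \<le> t \<and> B \<in> sets borel}"
    using order_trans[OF _ assms] by blast
  then show ?thesis
    unfolding sets_generated_filtration by (intro sigma_sets_mono' Un_mono subset_refl)
qed

lemma measurable_generated_filtration:
  assumes "0 \<le> r" "r \<le> t"
  shows "W r \<in> borel_measurable (generated_filtration M W t)"
proof (rule measurableI)
  fix B :: "real set" assume "B \<in> sets borel"
  then show "W r -` B \<inter> space (generated_filtration M W t) \<in> sets (generated_filtration M W t)"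
    using assms unfolding space_generated_filtration sets_generated_filtration by blast
qed simp

lemma subalgebra_generated_filtration:
  assumes "\<And>r. r \<in> {0..t} \<Longrightarrow> W r \<in> borel_measurable M"
  shows "subalgebra M (generated_filtration M W t)"
proof -
  have "{W r -` B \<inter> space M | r B. 0 \<le> r \<and> r \<le> t \<and> B \<in> sets borel} \<subseteq> sets M"
    using assms by (auto intro: measurable_sets)
  then show ?thesis
    unfolding subalgebra_def space_generated_filtration sets_generated_filtration
    by (intro conjI refl sets.sigma_sets_subset) auto
qed

lemma (in prob_space) indep_sigma_algebras_integral_mult:
  fixes X Y :: "'a \<Rightarrow> real"
  assumes indep: "indep_set (sets G) (sets H)" and space: "space G = space M" "space H = space M"
    and X: "X \<in> borel_measurable G" "integrable M X"
    and Y: "Y \<in> borel_measurable H" "integrable M Y"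
  shows "integrable M (\<lambda>\<omega>. X \<omega> * Y \<omega>)"
    and "(\<integral>\<omega>. X \<omega> * Y \<omega> \<partial>M) = (\<integral>\<omega>. X \<omega> \<partial>M) * (\<integral>\<omega>. Y \<omega> \<partial>M)"
proof -
  let ?A = "sigma_sets (space M) {X -` A \<inter> space M | A. A \<in> sets borel}"
  let ?B = "sigma_sets (space M) {Y -` A \<inter> space M | A. A \<in> sets borel}"
  have A: "?A \<subseteq> sets G"
    using sets.sigma_sets_subset[of "{X -` A \<inter> space M | A. A \<in> sets borel}" G]
      measurable_sets[OF X(1)] space by auto
  have B: "?B \<subseteq> sets H"
    using sets.sigma_sets_subset[of "{Y -` A \<inter> space M | A. A \<in> sets borel}" H]
      measurable_sets[OF Y(1)] space by auto
  have "indep_set ?A ?B"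
    using indep unfolding indep_set_def
    by (rule indep_sets_mono_sets) (use A B in \<open>auto split: bool.split\<close>)
  then have iv: "indep_var borel X borel Y"
    unfolding indep_var_eq using X(2) Y(2) by blast
  show "integrable M (\<lambda>\<omega>. X \<omega> * Y \<omega>)"
    by (rule indep_var_integrable[OF iv X(2) Y(2)])
  show "(\<integral>\<omega>. X \<omega> * Y \<omega> \<partial>M) = (\<integral>\<omega>. X \<omega> \<partial>M) * (\<integral>\<omega>. Y \<omega> \<partial>M)"
    by (rule indep_var_lebesgue_integral[OF iv X(2) Y(2)])
qed

lemma (in prob_space) normal_distributed_second_moment:
  assumes \<sigma>: "0 < \<sigma>" and D: "distributed M lborel Z (normal_density 0 \<sigma>)"
  shows "square_integrable M Z" "(\<integral>\<omega>. Z \<omega> \<partial>M) = 0" "(\<integral>\<omega>. (Z \<omega>)\<^sup>2 \<partial>M) = \<sigma>\<^sup>2"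
proof -
  show m: "(\<integral>\<omega>. Z \<omega> \<partial>M) = 0"
    by (rule normal_distributed_expectation[OF \<sigma> D])
  have "integrable lborel (\<lambda>z. normal_density 0 \<sigma> z * z\<^sup>2)"
    using integrable_normal_moment[OF \<sigma>, of 0 2] by simp
  then have "integrable M (\<lambda>\<omega>. (Z \<omega>)\<^sup>2)"
    using distributed_integrable[OF D, of "\<lambda>z. z\<^sup>2"] by simp
  moreover have "Z \<in> borel_measurable M" using distributed_measurable[OF D] by simp
  ultimately show "square_integrable M Z" by (simp add: square_integrable_def)
  show "(\<integral>\<omega>. (Z \<omega>)\<^sup>2 \<partial>M) = \<sigma>\<^sup>2"
    using normal_distributed_variance[OF \<sigma> D] m by simp
qed

context prob_space
begin

lemma brownian_motion_subalgebra:
  "brownian_motion M T B \<Longrightarrow> t \<le> T \<Longrightarrow> subalgebra M (generated_filtration M B t)"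
  by (rule subalgebra_generated_filtration) (auto simp: brownian_motion_def)

lemma brownian_motion_increment:
  assumes B: "brownian_motion M T B" and rt: "0 \<le> r" "r \<le> t" "t \<le> T"
  shows "square_integrable M (\<lambda>\<omega>. B t \<omega> - B r \<omega>)" (is ?a)
    and "(\<integral>\<omega>. B t \<omega> - B r \<omega> \<partial>M) = 0" (is ?b)
    and "(\<integral>\<omega>. (B t \<omega> - B r \<omega>)\<^sup>2 \<partial>M) = t - r" (is ?c)
proof -
  have "?a \<and> ?b \<and> ?c"
  proof (cases "r = t")
    case True
    then show ?thesis by (simp add: square_integrable_const)
  next
    case False
    then have "distributed M lborel (\<lambda>\<omega>. B t \<omega> - B r \<omega>) (normal_density 0 (sqrt (t - r)))"
      using B rt by (auto simp: brownian_motion_def)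
    from normal_distributed_second_moment[OF _ this] show ?thesis using rt False by auto
  qed
  then show ?a ?b ?c by auto
qed

text \<open>
  The martingale property in the form in which it replaces stochastic integration: a quantity
  known at time \<open>r\<close> is uncorrelated with the increment after \<open>r\<close>.
\<close>

lemma brownian_motion_increment_mult:
  assumes B: "brownian_motion M T B" and rt: "0 \<le> r" "r \<le> t" "t \<le> T"
    and Z: "Z \<in> borel_measurable (generated_filtration M B r)" "integrable M Z"
  shows "integrable M (\<lambda>\<omega>. Z \<omega> * (B t \<omega> - B r \<omega>))" (is ?a)
    and "(\<integral>\<omega>. Z \<omega> * (B t \<omega> - B r \<omega>) \<partial>M) = 0" (is ?b)
proof -
  have "?a \<and> ?b"
  proof (cases "r = t")
    case False
    let ?H = "vimage_algebra (space M) (\<lambda>\<omega>. B t \<omega> - B r \<omega>) borel"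
    have "indep_set (sets (generated_filtration M B r)) (sets ?H)"
      using B rt False by (auto simp: brownian_motion_def)
    note mult = indep_sigma_algebras_integral_mult[OF this _ _ Z _
        square_integrable_integrable[OF brownian_motion_increment(1)[OF B rt]]]
    have "(\<lambda>\<omega>. B t \<omega> - B r \<omega>) \<in> borel_measurable ?H"
      by (rule measurable_vimage_algebra1) simp
    from mult[OF _ _ this] show ?thesis
      unfolding brownian_motion_increment(2)[OF B rt] by simp
  qed simp
  then show ?a ?b by auto
qed

lemma brownian_motion_marginal:
  assumes B: "brownian_motion M T B" and t: "0 \<le> t" "t \<le> T"
  shows "square_integrable M (B t)" "(\<integral>\<omega>. B t \<omega> \<partial>M) = 0" "(\<integral>\<omega>. (B t \<omega>)\<^sup>2 \<partial>M) = t"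
proof -
  have [measurable]: "B t \<in> borel_measurable M" "B 0 \<in> borel_measurable M"
    using B t by (auto simp: brownian_motion_def)
  have ae: "AE \<omega> in M. B t \<omega> - B 0 \<omega> = B t \<omega>"
    using B by (auto simp: brownian_motion_def)
  then have ae2: "AE \<omega> in M. (B t \<omega> - B 0 \<omega>)\<^sup>2 = (B t \<omega>)\<^sup>2" by eventually_elim simp
  note inc = brownian_motion_increment[OF B order_refl t]
  have "integrable M (\<lambda>\<omega>. (B t \<omega>)\<^sup>2)"
    by (rule integrable_cong_AE_imp[OF _ _ ae2]) (use inc(1) in \<open>auto simp: square_integrable_def\<close>)
  then show "square_integrable M (B t)" by (simp add: square_integrable_def)
  show "(\<integral>\<omega>. B t \<omega> \<partial>M) = 0"
    using integral_cong_AE[OF _ _ ae] inc(2) by simp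
  show "(\<integral>\<omega>. (B t \<omega>)\<^sup>2 \<partial>M) = t"
    using integral_cong_AE[OF _ _ ae2] inc(3) by simp
qed

text \<open>
  The constant, the value at \<open>s\<close> and the increment after \<open>s\<close> are pairwise orthogonal, so the
  second moments add.  With \<open>W\<close> for \<open>B\<close> this describes the uncontrolled observed state, with \<open>V\<close>
  for \<open>B\<close> the unobserved part of the state.
\<close>

lemma brownian_motion_combination:
  assumes B: "brownian_motion M T B" and st: "0 \<le> s" "s \<le> t" "t \<le> T"
  shows "square_integrable M (\<lambda>\<omega>. c + a * B s \<omega> + b * (B t \<omega> - B s \<omega>))" (is "square_integrable M ?n")
    and "(\<integral>\<omega>. c + a * B s \<omega> + b * (B t \<omega> - B s \<omega>) \<partial>M) = c"
    and "(\<integral>\<omega>. (c + a * B s \<omega> + b * (B t \<omega> - B s \<omega>))\<^sup>2 \<partial>M) = c\<^sup>2 + a\<^sup>2 * s + b\<^sup>2 * (t - s)"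
proof -
  let ?A = "B s" and ?I = "\<lambda>\<omega>. B t \<omega> - B s \<omega>"
  note A = brownian_motion_marginal[OF B st(1) order_trans[OF st(2,3)]]
  note I = brownian_motion_increment[OF B st]
  have AI: "integrable M (\<lambda>\<omega>. ?A \<omega> * ?I \<omega>)" "(\<integral>\<omega>. ?A \<omega> * ?I \<omega> \<partial>M) = 0"
    by (rule brownian_motion_increment_mult[OF B st measurable_generated_filtration[OF st(1) order_refl]
          square_integrable_integrable[OF A(1)]])+
  show "square_integrable M ?n"
    by (intro square_integrable_add square_integrable_cmult square_integrable_const A I)
  have iA: "integrable M ?A" "integrable M (\<lambda>\<omega>. (?A \<omega>)\<^sup>2)"
    and iI: "integrable M ?I" "integrable M (\<lambda>\<omega>. (?I \<omega>)\<^sup>2)"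
    using square_integrable_integrable[OF A(1)] square_integrable_integrable[OF I(1)] A(1) I(1)
    unfolding square_integrable_def by blast+
  have "(\<integral>\<omega>. ?n \<omega> \<partial>M) = (\<integral>\<omega>. c \<partial>M) + a * (\<integral>\<omega>. ?A \<omega> \<partial>M) + b * (\<integral>\<omega>. ?I \<omega> \<partial>M)"
    using iA(1) iI(1) by (subst Bochner_Integration.integral_add; simp)+
  then show "(\<integral>\<omega>. ?n \<omega> \<partial>M) = c" unfolding A(2) I(2) by (simp add: prob_space)
  have "(\<integral>\<omega>. (?n \<omega>)\<^sup>2 \<partial>M) = (\<integral>\<omega>. c\<^sup>2 + (a\<^sup>2 * (?A \<omega>)\<^sup>2 + (b\<^sup>2 * (?I \<omega>)\<^sup>2 +
      (2 * c * a * ?A \<omega> + (2 * c * b * ?I \<omega> + 2 * a * b * (?A \<omega> * ?I \<omega>))))) \<partial>M)"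
    by (intro Bochner_Integration.integral_cong refl) (simp add: power2_eq_square algebra_simps)
  also have "\<dots> = (\<integral>\<omega>. c\<^sup>2 \<partial>M) + (a\<^sup>2 * (\<integral>\<omega>. (?A \<omega>)\<^sup>2 \<partial>M) + (b\<^sup>2 * (\<integral>\<omega>. (?I \<omega>)\<^sup>2 \<partial>M) +
      (2 * c * a * (\<integral>\<omega>. ?A \<omega> \<partial>M) + (2 * c * b * (\<integral>\<omega>. ?I \<omega> \<partial>M) +
       2 * a * b * (\<integral>\<omega>. ?A \<omega> * ?I \<omega> \<partial>M)))))"
    using iA iI AI(1)
    by (simp only: Bochner_Integration.integral_add Bochner_Integration.integrable_add
        integrable_mult_right Bochner_Integration.integral_mult_right_zero integrable_const)
  finally show "(\<integral>\<omega>. (?n \<omega>)\<^sup>2 \<partial>M) = c\<^sup>2 + a\<^sup>2 * s + b\<^sup>2 * (t - s)"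
    unfolding A(2,3) I(2,3) AI(2) by (simp add: prob_space)
qed

end

lemma (in sigma_finite_subalgebra) real_cond_exp_square_integrable:
  assumes Y: "integrable M Y" "square_integrable M Y"
  shows "square_integrable M (real_cond_exp M F Y)"
  unfolding square_integrable_def
proof
  show "real_cond_exp M F Y \<in> borel_measurable M" by simp
  have "convex_on UNIV (\<lambda>y::real. y\<^sup>2)" by (rule convex_on_realI[where f'="\<lambda>y. 2 * y"]) (auto intro!: derivative_eq_intros)
  from real_cond_exp_jensens_inequality(2)[OF Y(1) _ _ _ this, of 0 0]
  have "AE \<omega> in M. (real_cond_exp M F Y \<omega>)\<^sup>2 \<le> real_cond_exp M F (\<lambda>\<omega>. (Y \<omega>)\<^sup>2) \<omega>"
    using Y(2) by (simp add: square_integrable_def)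
  then have ae: "AE \<omega> in M. norm ((real_cond_exp M F Y \<omega>)\<^sup>2) \<le> norm (real_cond_exp M F (\<lambda>\<omega>. (Y \<omega>)\<^sup>2) \<omega>)"
    by eventually_elim simp
  have "integrable M (real_cond_exp M F (\<lambda>\<omega>. (Y \<omega>)\<^sup>2))"
    by (rule real_cond_exp_int) (use Y in \<open>simp add: square_integrable_def\<close>)
  then show "integrable M (\<lambda>\<omega>. (real_cond_exp M F Y \<omega>)\<^sup>2)"
    by (rule Bochner_Integration.integrable_bound[OF _ _ ae]) measurable
qed


section \<open>The controlled state and its observed part\<close>

text \<open>
  The set \<open>N\<close> contains the paths of \<open>W\<close> that fail to be continuous.  Fixing it gives a version of
  \<open>W\<close> with continuous paths throughout, as the pathwise solution of the feedback equation needs.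
\<close>

locale lq_control =
  fixes M :: "'a measure" and F :: "real \<Rightarrow> 'a measure"
    and W V :: "real \<Rightarrow> 'a \<Rightarrow> real"
    and T s x D\<^sub>1 D\<^sub>2 \<sigma>\<^sub>W \<sigma>\<^sub>V \<eta>\<^sub>W \<eta>\<^sub>V :: real
    and \<phi>\<^sub>1 \<phi>\<^sub>2 \<phi>\<^sub>3 :: "real \<Rightarrow> real"
    and N :: "'a set"
  assumes s: "s \<in> {0..T}"
    and basis: "two_brownian_basis M F T W V"
    and riccati: "riccati_solution T D\<^sub>1 D\<^sub>2 \<sigma>\<^sub>W \<phi>\<^sub>1 \<phi>\<^sub>2 \<phi>\<^sub>3"
    and null_N: "N \<in> null_sets M"
    and continuous_off_N: "\<And>\<omega>. \<omega> \<in> space M - N \<Longrightarrow> continuous_on {0..T} (\<lambda>t. W t \<omega>)"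

sublocale lq_control \<subseteq> prob_space M
  using basis by (simp add: two_brownian_basis_def)

context lq_control
begin

abbreviation "time \<equiv> restrict_space lborel {s..T}"
abbreviation "GW \<equiv> generated_filtration M W"
abbreviation "GV \<equiv> generated_filtration M V"
abbreviation "X \<equiv> state s x \<eta>\<^sub>W \<eta>\<^sub>V \<sigma>\<^sub>W \<sigma>\<^sub>V W V"

lemma s_bounds: "0 \<le> s" "s \<le> T" "0 \<le> T"
  using s by auto

lemma bm_W: "brownian_motion M T W" and bm_V: "brownian_motion M T V"
  using basis by (auto simp: two_brownian_basis_def)

lemma subalgebra_GW: "t \<le> T \<Longrightarrow> subalgebra M (GW t)"
  by (rule brownian_motion_subalgebra[OF bm_W])

lemma measurable_GW: "f \<in> borel_measurable (GW t) \<Longrightarrow> t \<le> T \<Longrightarrow> f \<in> borel_measurable M"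
  by (rule measurable_from_subalg[OF subalgebra_GW])

lemma measurable_GW_mono:
  "f \<in> borel_measurable (GW r) \<Longrightarrow> r \<le> t \<Longrightarrow> f \<in> borel_measurable (GW t)"
  by (rule measurable_from_subalg[rotated])
     (auto simp: subalgebra_def dest: generated_filtration_mono)

sublocale time: finite_measure time
  by (rule finite_measureI)
     (use s_bounds in \<open>simp add: emeasure_restrict_space space_restrict_space\<close>)

sublocale pair_sigma_finite time M ..

sublocale time_M: finite_measure "time \<Otimes>\<^sub>M M"
  by (rule finite_measure_pair_measure) unfold_locales

lemma space_time [simp]: "space time = {s..T}"
  by (simp add: space_restrict_space)

lemma set_integrable_time: "set_integrable lborel {s..T} f \<longleftrightarrow> integrable time f" for f :: "real \<Rightarrow> real"
  by (simp add: set_integrable_def integrable_restrict_space)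

lemma set_integral_time:
  fixes f :: "real \<Rightarrow> real"
  assumes "t \<in> {s..T}"
  shows "(LINT r:{s..t}|lborel. f r) = (\<integral>r. indicator {..t} r * f r \<partial>time)"
proof -
  have "(\<integral>r. indicator {..t} r * f r \<partial>time) = (\<integral>r. indicator {s..T} r *\<^sub>R (indicator {..t} r * f r) \<partial>lborel)"
    by (simp add: integral_restrict_space)
  also have "\<dots> = (LINT r:{s..t}|lborel. f r)"
    unfolding set_lebesgue_integral_def
    by (rule Bochner_Integration.integral_cong) (use assms in \<open>auto simp: indicator_def\<close>)
  finally show ?thesis by simp
qed

lemma set_integral_time_T: "(LINT r:{s..T}|lborel. f r) = (\<integral>r. f r \<partial>time)" for f :: "real \<Rightarrow> real"
  by (simp add: set_lebesgue_integral_def integral_restrict_space)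

lemma AE_time: "(AE r in time. P r) \<longleftrightarrow> (AE r in lborel. r \<in> {s..T} \<longrightarrow> P r)"
  by (rule AE_restrict_space_iff) simp

lemma expectation_time_integral:
  fixes f :: "real \<Rightarrow> 'a \<Rightarrow> real"
  assumes f: "integrable (time \<Otimes>\<^sub>M M) (\<lambda>(r, \<omega>). f r \<omega>)" and t: "t \<in> {s..T}"
  shows "integrable time (\<lambda>r. \<integral>\<omega>. f r \<omega> \<partial>M)"
    and "integrable M (\<lambda>\<omega>. LINT r:{s..t}|lborel. f r \<omega>)"
    and "(\<integral>\<omega>. (LINT r:{s..t}|lborel. f r \<omega>) \<partial>M) = (LINT r:{s..t}|lborel. (\<integral>\<omega>. f r \<omega> \<partial>M))"
proof -
  show "integrable time (\<lambda>r. \<integral>\<omega>. f r \<omega> \<partial>M)" by (rule integrable_fst[OF f])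
  have [measurable]: "(\<lambda>x. f (fst x) (snd x)) \<in> borel_measurable (time \<Otimes>\<^sub>M M)"
    using borel_measurable_integrable[OF f] by (simp add: split_beta')
  have "(\<lambda>r. indicator {..t} r :: real) \<in> borel_measurable time"
    by (simp add: measurable_restrict_space1)
  from measurable_compose[OF measurable_fst this]
  have [measurable]: "(\<lambda>z. indicator {..t} (fst z) :: real) \<in> borel_measurable (time \<Otimes>\<^sub>M M)" .
  have "integrable (time \<Otimes>\<^sub>M M) (\<lambda>(r, \<omega>). indicator {..t} r * f r \<omega>)"
    by (rule Bochner_Integration.integrable_bound[OF f])
       (simp_all add: split_beta' abs_mult mult_left_le_one_le)
  note int = this
  show "integrable M (\<lambda>\<omega>. LINT r:{s..t}|lborel. f r \<omega>)"
    using integrable_snd[OF int] by (simp add: set_integral_time[OF t])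
  show "(\<integral>\<omega>. (LINT r:{s..t}|lborel. f r \<omega>) \<partial>M) = (LINT r:{s..t}|lborel. (\<integral>\<omega>. f r \<omega> \<partial>M))"
    using integral_snd[OF int] integral_fst[OF int] by (simp add: set_integral_time[OF t])
qed

lemma square_integrable_timeI:
  fixes f :: "real \<Rightarrow> 'a \<Rightarrow> real"
  assumes [measurable]: "(\<lambda>(r, \<omega>). f r \<omega>) \<in> borel_measurable (time \<Otimes>\<^sub>M M)"
    and f: "\<And>r. r \<in> {s..T} \<Longrightarrow> square_integrable M (f r)"
    and C: "\<And>r. r \<in> {s..T} \<Longrightarrow> (\<integral>\<omega>. (f r \<omega>)\<^sup>2 \<partial>M) \<le> C"
  shows "square_integrable (time \<Otimes>\<^sub>M M) (\<lambda>(r, \<omega>). f r \<omega>)"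
  unfolding square_integrable_def
proof
  have [measurable]: "(\<lambda>x. f (fst x) (snd x)) \<in> borel_measurable (time \<Otimes>\<^sub>M M)"
    using assms(1) by (simp add: split_beta')
  have "integrable (time \<Otimes>\<^sub>M M) (\<lambda>z. (f (fst z) (snd z))\<^sup>2)"
  proof (rule Fubini_integrable)
    show "integrable time (\<lambda>r. \<integral>\<omega>. norm ((f (fst (r, \<omega>)) (snd (r, \<omega>)))\<^sup>2) \<partial>M)"
      by (rule time.integrable_const_bound[where B=C]) (use C in auto)
    show "AE r in time. integrable M (\<lambda>\<omega>. (f (fst (r, \<omega>)) (snd (r, \<omega>)))\<^sup>2)"
      by (rule AE_I2) (use f in \<open>auto simp: square_integrable_def\<close>)
  qed measurable
  then show "integrable (time \<Otimes>\<^sub>M M) (\<lambda>z. (case z of (r, \<omega>) \<Rightarrow> f r \<omega>)\<^sup>2)"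
    by (simp add: split_beta')
qed fact

text \<open>
  Resetting \<open>W\<close> to zero on \<open>N\<close> does not leave the filtration of \<open>W\<close>, since that filtration contains
  the null sets.
\<close>

definition Wc :: "real \<Rightarrow> 'a \<Rightarrow> real" where
  "Wc t \<omega> = (if \<omega> \<in> N then 0 else W t \<omega>)"

text \<open>
  The observed state in the absence of control.  The minimum \<open>min s t\<close> makes it an adapted
  continuous process on all of \<open>{0..T}\<close>; from time \<open>s\<close> on it is \<open>s\<close>.
\<close>

definition noise :: "real \<Rightarrow> 'a \<Rightarrow> real" where
  "noise t \<omega> = x + \<eta>\<^sub>W * Wc (min s t) \<omega> + \<sigma>\<^sub>W * (Wc t \<omega> - Wc (min s t) \<omega>)"

definition drift :: "(real \<Rightarrow> 'a \<Rightarrow> real) \<Rightarrow> real \<Rightarrow> 'a \<Rightarrow> real" where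
  "drift u t \<omega> = (LINT r:{s..t}|lborel. u r \<omega>)"

text \<open>
  For an observable control this is the prediction of the state (\<open>prediction_eq\<close>), in a version that is jointly measurable in
  time and chance.  Conditional expectations are determined only up to a null set depending on the
  time, so that their integrals over time need such a version.
\<close>

definition observed :: "(real \<Rightarrow> 'a \<Rightarrow> real) \<Rightarrow> real \<Rightarrow> 'a \<Rightarrow> real" where
  "observed u t \<omega> = noise t \<omega> + drift u t \<omega>"

text \<open>
  The part of the state about which \<open>W\<close> carries no information.
\<close>

definition hidden :: "real \<Rightarrow> 'a \<Rightarrow> real" where
  "hidden t \<omega> = \<eta>\<^sub>V * V s \<omega> + \<sigma>\<^sub>V * (V t \<omega> - V s \<omega>)"

text \<open>
  The consequence of admissibility on which the prediction formula and the cost identity rest: the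
  control at time \<open>r\<close> is a function of \<open>W\<close> up to \<open>r\<close>.  The representative \<open>h\<close> is chosen for each
  time separately, because a controller may depend on time in a non-measurable way.
\<close>

definition observable_control :: "(real \<Rightarrow> 'a \<Rightarrow> real) \<Rightarrow> bool" where
  "observable_control u \<longleftrightarrow>
     square_integrable (time \<Otimes>\<^sub>M M) (\<lambda>(r, \<omega>). u r \<omega>) \<and>
     (\<forall>r\<in>{s..T}. \<exists>h\<in>borel_measurable (GW r). AE \<omega> in M. u r \<omega> = h \<omega>)"

lemma Wc_AE: "AE \<omega> in M. \<forall>t. Wc t \<omega> = W t \<omega>"
  using AE_not_in[OF null_N] by eventually_elim (simp add: Wc_def)

lemma Wc_measurable: "0 \<le> r \<Longrightarrow> r \<le> t \<Longrightarrow> Wc r \<in> borel_measurable (GW t)"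
  unfolding Wc_def
proof (rule measurable_If_set)
  have "N \<in> sets (GW t)" using null_N null_sets_generated_filtration by blast
  then show "N \<inter> space (GW t) \<in> sets (GW t)" by (intro sets.Int sets.top)
qed (auto intro: measurable_generated_filtration)

lemma Wc_continuous: "\<omega> \<in> space M \<Longrightarrow> continuous_on {0..T} (\<lambda>t. Wc t \<omega>)"
  using continuous_off_N by (cases "\<omega> \<in> N") (auto simp: Wc_def)

lemma noise_measurable:
  assumes "0 \<le> t" shows "noise t \<in> borel_measurable (GW t)"
proof -
  have [measurable]: "Wc (min s t) \<in> borel_measurable (GW t)" "Wc t \<in> borel_measurable (GW t)"
    using assms s_bounds by (auto intro!: Wc_measurable)
  show ?thesis unfolding noise_def by measurable
qed

lemma noise_continuous:
  assumes "\<omega> \<in> space M" shows "continuous_on {0..T} (\<lambda>t. noise t \<omega>)"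
proof -
  have "continuous_on {0..T} (\<lambda>t. Wc (min s t) \<omega>)"
    by (rule continuous_on_compose2[OF Wc_continuous[OF assms]])
       (use s_bounds in \<open>auto intro!: continuous_intros\<close>)
  then show ?thesis unfolding noise_def
    by (intro continuous_intros Wc_continuous[OF assms])
qed

lemma noise_AE:
  assumes "t \<in> {s..T}"
  shows "AE \<omega> in M. noise t \<omega> = x + \<eta>\<^sub>W * W s \<omega> + \<sigma>\<^sub>W * (W t \<omega> - W s \<omega>)"
  using Wc_AE by eventually_elim (use assms in \<open>simp add: noise_def\<close>)

lemma noise_increment:
  assumes "s \<le> r" "r \<le> t"
  shows "AE \<omega> in M. noise t \<omega> = noise r \<omega> + \<sigma>\<^sub>W * (W t \<omega> - W r \<omega>)"
  using Wc_AE by eventually_elim (use assms in \<open>simp add: noise_def algebra_simps\<close>)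

lemma noise_moments:
  assumes t: "t \<in> {s..T}"
  shows "square_integrable M (noise t)" "(\<integral>\<omega>. noise t \<omega> \<partial>M) = x"
    "(\<integral>\<omega>. (noise t \<omega>)\<^sup>2 \<partial>M) = x\<^sup>2 + \<eta>\<^sub>W\<^sup>2 * s + \<sigma>\<^sub>W\<^sup>2 * (t - s)"
proof -
  let ?n = "\<lambda>\<omega>. x + \<eta>\<^sub>W * W s \<omega> + \<sigma>\<^sub>W * (W t \<omega> - W s \<omega>)"
  have st: "0 \<le> s" "s \<le> t" "t \<le> T" using s_bounds t by auto
  note n = brownian_motion_combination[OF bm_W st, of x \<eta>\<^sub>W \<sigma>\<^sub>W]
  have nm [measurable]: "noise t \<in> borel_measurable M" "?n \<in> borel_measurable M"
    using measurable_GW[OF noise_measurable] st square_integrable_measurable[OF n(1)] by auto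
  have ae: "AE \<omega> in M. noise t \<omega> = ?n \<omega>" by (rule noise_AE[OF t])
  then have ae2: "AE \<omega> in M. (noise t \<omega>)\<^sup>2 = (?n \<omega>)\<^sup>2" by eventually_elim simp
  have "integrable M (\<lambda>\<omega>. (noise t \<omega>)\<^sup>2) \<longleftrightarrow> integrable M (\<lambda>\<omega>. (?n \<omega>)\<^sup>2)"
    by (rule integrable_cong_AE[OF _ _ ae2]) (use nm in measurable)
  then show "square_integrable M (noise t)"
    using n(1) nm by (simp add: square_integrable_def)
  show "(\<integral>\<omega>. noise t \<omega> \<partial>M) = x"
    using integral_cong_AE[OF nm ae] n(2) by simp
  have "(\<integral>\<omega>. (noise t \<omega>)\<^sup>2 \<partial>M) = (\<integral>\<omega>. (?n \<omega>)\<^sup>2 \<partial>M)"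
    by (rule integral_cong_AE[OF _ _ ae2]) (use nm in measurable)
  then show "(\<integral>\<omega>. (noise t \<omega>)\<^sup>2 \<partial>M) = x\<^sup>2 + \<eta>\<^sub>W\<^sup>2 * s + \<sigma>\<^sub>W\<^sup>2 * (t - s)"
    using n(3) by simp
qed

lemma measurable_timeI:
  assumes "(\<lambda>(r, \<omega>). f r \<omega>) \<in> borel_measurable (restrict_space borel {0..T} \<Otimes>\<^sub>M G)"
    and "sets G = sets M"
  shows "(\<lambda>(r, \<omega>). f r \<omega>) \<in> borel_measurable (time \<Otimes>\<^sub>M M)"
proof -
  have "(\<lambda>r. r) \<in> measurable time (restrict_space borel {0..T})"
    by (rule measurable_restrict_space2) (use s_bounds in \<open>auto intro!: measurable_restrict_space1\<close>)
  then have "(\<lambda>z. (fst z, snd z)) \<in> measurable (time \<Otimes>\<^sub>M M) (restrict_space borel {0..T} \<Otimes>\<^sub>M M)"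
    by (intro measurable_Pair measurable_snd measurable_compose[OF measurable_fst])
  moreover have "(\<lambda>(r, \<omega>). f r \<omega>) \<in> borel_measurable (restrict_space borel {0..T} \<Otimes>\<^sub>M M)"
    using assms by (simp cong: measurable_cong_sets sets_pair_measure_cong)
  ultimately show ?thesis
    by (auto dest: measurable_compose)
qed

lemma noise_square_integrable: "square_integrable (time \<Otimes>\<^sub>M M) (\<lambda>(r, \<omega>). noise r \<omega>)"
proof (rule square_integrable_timeI)
  show "(\<lambda>(r, \<omega>). noise r \<omega>) \<in> borel_measurable (time \<Otimes>\<^sub>M M)"
    by (rule measurable_timeI[OF caratheodory_measurable refl])
       (auto intro!: measurable_GW[OF noise_measurable] noise_continuous)
  fix r assume r: "r \<in> {s..T}"
  show "square_integrable M (noise r)" by (rule noise_moments[OF r])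
  show "(\<integral>\<omega>. (noise r \<omega>)\<^sup>2 \<partial>M) \<le> x\<^sup>2 + \<eta>\<^sub>W\<^sup>2 * s + \<sigma>\<^sub>W\<^sup>2 * (T - s)"
    unfolding noise_moments(3)[OF r] using r by (auto intro!: mult_left_mono)
qed

lemma drift_measurable_time:
  assumes "(\<lambda>(r, \<omega>). u r \<omega>) \<in> borel_measurable (time \<Otimes>\<^sub>M M)"
  shows "(\<lambda>(r, \<omega>). drift u r \<omega>) \<in> borel_measurable (time \<Otimes>\<^sub>M M)"
proof -
  have [measurable]: "(\<lambda>z. u (fst z) (snd z)) \<in> borel_measurable (time \<Otimes>\<^sub>M M)"
    using assms by (simp add: split_beta')
  have id [measurable]: "(\<lambda>r. r) \<in> borel_measurable time"
    by (simp add: measurable_restrict_space1)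
  have "(\<lambda>z. \<integral>r. (if r \<le> fst z then 1 else 0) * u r (snd z) \<partial>time) \<in> borel_measurable (time \<Otimes>\<^sub>M M)"
  proof (rule time.borel_measurable_lebesgue_integral)
    have [measurable]: "(\<lambda>y. u (snd y) (snd (fst y))) \<in> borel_measurable ((time \<Otimes>\<^sub>M M) \<Otimes>\<^sub>M time)"
      by (rule measurable_compose[of "\<lambda>y. (snd y, snd (fst y))" _ "time \<Otimes>\<^sub>M M" "\<lambda>z. u (fst z) (snd z)", simplified])
         measurable
    have [measurable]: "(\<lambda>y. fst (fst y)) \<in> borel_measurable ((time \<Otimes>\<^sub>M M) \<Otimes>\<^sub>M time)"
      "(\<lambda>y. snd y) \<in> borel_measurable ((time \<Otimes>\<^sub>M M) \<Otimes>\<^sub>M time)"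
      by (rule measurable_compose[OF _ id], measurable)+
    show "(\<lambda>(z, r). (if r \<le> fst z then 1 else 0) * u r (snd z)) \<in> borel_measurable ((time \<Otimes>\<^sub>M M) \<Otimes>\<^sub>M time)"
      unfolding split_beta' by measurable
  qed
  also have "(\<lambda>z. \<integral>r. (if r \<le> fst z then 1 else 0) * u r (snd z) \<partial>time) \<in> borel_measurable (time \<Otimes>\<^sub>M M) \<longleftrightarrow>
      (\<lambda>(r, \<omega>). drift u r \<omega>) \<in> borel_measurable (time \<Otimes>\<^sub>M M)"
  proof (rule measurable_cong)
    fix z assume "z \<in> space (time \<Otimes>\<^sub>M M)"
    then obtain t \<omega> where z: "z = (t, \<omega>)" "t \<in> {s..T}" by (auto simp: space_pair_measure)
    show "(\<integral>r. (if r \<le> fst z then 1 else 0) * u r (snd z) \<partial>time) = (case z of (r, \<omega>) \<Rightarrow> drift u r \<omega>)"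
      unfolding z(1) by (simp add: drift_def set_integral_time[OF z(2)] indicator_def of_bool_def)
  qed
  finally show ?thesis .
qed

text \<open>
  By the Cauchy--Schwarz inequality in time, the square of the accumulated control up to \<open>t\<close> is at
  most a constant times \<open>\<integral> u\<^sub>r\<^sup>2 dr\<close> over \<open>{s..T}\<close>, uniformly in \<open>t\<close>.
\<close>

lemma drift_square_integrable:
  assumes u: "square_integrable (time \<Otimes>\<^sub>M M) (\<lambda>(r, \<omega>). u r \<omega>)"
  shows "\<And>t. t \<in> {s..T} \<Longrightarrow> square_integrable M (drift u t)"
    and "square_integrable (time \<Otimes>\<^sub>M M) (\<lambda>(r, \<omega>). drift u r \<omega>)"
proof -
  have um [measurable]: "(\<lambda>(r, \<omega>). u r \<omega>) \<in> borel_measurable (time \<Otimes>\<^sub>M M)"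
    by (rule square_integrable_measurable[OF u])
  have u2: "integrable (time \<Otimes>\<^sub>M M) (\<lambda>(r, \<omega>). (u r \<omega>)\<^sup>2)"
    using u by (simp add: square_integrable_def split_beta')
  let ?c = "measure time (space time)"
  let ?b = "\<lambda>\<omega>. ?c * (\<integral>r. (u r \<omega>)\<^sup>2 \<partial>time)"
  have b: "integrable M ?b"
    using integrable_snd[OF u2] by simp
  have d: "drift u t \<in> borel_measurable M" if t: "t \<in> {s..T}" for t
    using measurable_Pair2[OF drift_measurable_time[OF um], of t] t by simp
  have bound: "AE \<omega> in M. (drift u t \<omega>)\<^sup>2 \<le> ?b \<omega>" if t: "t \<in> {s..T}" for t
    using AE_integrable_snd[OF u2]
  proof (rule AE_mp, intro AE_I2 impI)
    fix \<omega> assume \<omega>: "\<omega> \<in> space M" and int: "integrable time (\<lambda>r. (u r \<omega>)\<^sup>2)"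
    have "(\<lambda>r. u r \<omega>) \<in> borel_measurable time"
      using measurable_Pair1[OF um \<omega>] by simp
    then have sq: "square_integrable time (\<lambda>r. u r \<omega>)"
      using int by (simp add: square_integrable_def)
    have ind: "(indicator {..t} :: real \<Rightarrow> real) \<in> borel_measurable time"
      by (simp add: measurable_restrict_space1)
    have sq': "square_integrable time (\<lambda>r. indicator {..t} r * u r \<omega>)"
      by (rule square_integrable_bounded_mult[OF sq ind, of 1]) (simp add: indicator_def)
    have "(drift u t \<omega>)\<^sup>2 \<le> ?c * (\<integral>r. (indicator {..t} r * u r \<omega>)\<^sup>2 \<partial>time)"
      unfolding drift_def set_integral_time[OF t] by (rule time.integral_square_le[OF sq'])
    also have "\<dots> \<le> ?b \<omega>"
      by (intro mult_left_mono integral_mono)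
         (use sq sq' in \<open>auto simp: square_integrable_def indicator_def\<close>)
    finally show "(drift u t \<omega>)\<^sup>2 \<le> ?b \<omega>" .
  qed
  show sq: "square_integrable M (drift u t)" if t: "t \<in> {s..T}" for t
    unfolding square_integrable_def
  proof
    show "drift u t \<in> borel_measurable M" by (rule d[OF t])
    have "AE \<omega> in M. norm ((drift u t \<omega>)\<^sup>2) \<le> norm (?b \<omega>)"
      using bound[OF t] by eventually_elim simp
    then show "integrable M (\<lambda>\<omega>. (drift u t \<omega>)\<^sup>2)"
      by (rule Bochner_Integration.integrable_bound[OF b, rotated]) (use d[OF t] in measurable)
  qed
  show "square_integrable (time \<Otimes>\<^sub>M M) (\<lambda>(r, \<omega>). drift u r \<omega>)"
  proof (rule square_integrable_timeI[OF drift_measurable_time[OF um] sq])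
    fix r assume r: "r \<in> {s..T}"
    show "(\<integral>\<omega>. (drift u r \<omega>)\<^sup>2 \<partial>M) \<le> (\<integral>\<omega>. ?b \<omega> \<partial>M)"
      by (rule integral_mono_AE[OF _ b bound[OF r]]) (use sq[OF r] in \<open>simp add: square_integrable_def\<close>)
  qed
qed

section \<open>The prediction process\<close>

lemma AE_square_integrable:
  assumes f: "square_integrable (time \<Otimes>\<^sub>M M) (\<lambda>(r, \<omega>). f r \<omega>)"
  shows "AE r in time. square_integrable M (f r)"
proof -
  have "integrable (time \<Otimes>\<^sub>M M) (\<lambda>(r, \<omega>). (f r \<omega>)\<^sup>2)"
    using f by (simp add: square_integrable_def split_beta')
  from AE_integrable_fst[OF this] show ?thesis
  proof (rule AE_mp, intro AE_I2 impI)
    fix r assume "r \<in> space time" "integrable M (\<lambda>\<omega>. (f r \<omega>)\<^sup>2)"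
    then show "square_integrable M (f r)"
      using measurable_Pair2[OF square_integrable_measurable[OF f], of r]
      by (simp add: square_integrable_def)
  qed
qed

lemma square_integrable_const_time:
  assumes "square_integrable M D"
  shows "square_integrable (time \<Otimes>\<^sub>M M) (\<lambda>(r, \<omega>). D \<omega>)"
proof (rule square_integrable_timeI)
  have [measurable]: "D \<in> borel_measurable M" by (rule square_integrable_measurable[OF assms])
  show "(\<lambda>(r, \<omega>). D \<omega>) \<in> borel_measurable (time \<Otimes>\<^sub>M M)" by simp
qed (use assms in auto)

lemma square_integrable_time_mult:
  assumes "square_integrable (time \<Otimes>\<^sub>M M) (\<lambda>(r, \<omega>). f r \<omega>)"
    and "square_integrable (time \<Otimes>\<^sub>M M) (\<lambda>(r, \<omega>). g r \<omega>)"
  shows "integrable (time \<Otimes>\<^sub>M M) (\<lambda>(r, \<omega>). f r \<omega> * g r \<omega>)"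
  using square_integrable_mult[OF assms] by (simp add: split_beta')

text \<open>
  Only for almost every time, since square integrability over time and chance leaves a null set of
  times at which the second moment may be infinite.
\<close>

lemma AE_observable_representative:
  assumes u: "observable_control u"
  shows "AE r in time. \<exists>h\<in>borel_measurable (GW r). square_integrable M h \<and> (AE \<omega> in M. u r \<omega> = h \<omega>)"
proof -
  have "AE r in time. square_integrable M (u r)"
    by (rule AE_square_integrable) (use u in \<open>simp add: observable_control_def\<close>)
  then show ?thesis
  proof (rule AE_mp, intro AE_I2 impI)
    fix r assume r: "r \<in> space time" and sq: "square_integrable M (u r)"
    have "\<exists>h\<in>borel_measurable (GW r). AE \<omega> in M. u r \<omega> = h \<omega>"
      using u r unfolding observable_control_def space_time by blast
    then obtain h where h: "h \<in> borel_measurable (GW r)" "AE \<omega> in M. u r \<omega> = h \<omega>" by blast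
    have hm [measurable]: "h \<in> borel_measurable M" using measurable_GW[OF h(1)] r by simp
    have um [measurable]: "u r \<in> borel_measurable M" by (rule square_integrable_measurable[OF sq])
    have "AE \<omega> in M. (u r \<omega>)\<^sup>2 = (h \<omega>)\<^sup>2" using h(2) by eventually_elim simp
    then have "integrable M (\<lambda>\<omega>. (u r \<omega>)\<^sup>2) \<longleftrightarrow> integrable M (\<lambda>\<omega>. (h \<omega>)\<^sup>2)"
      by (rule integrable_cong_AE[rotated 2]) measurable
    then have "square_integrable M h"
      using sq hm by (simp add: square_integrable_def)
    then show "\<exists>h\<in>borel_measurable (GW r). square_integrable M h \<and> (AE \<omega> in M. u r \<omega> = h \<omega>)"
      using h by blast
  qed
qed

lemma set_integral_time_cong:
  assumes "AE r in time. f r = (g r :: real)" "f \<in> borel_measurable time" "g \<in> borel_measurable time"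
    and t: "t \<in> {s..T}"
  shows "(LINT r:{s..t}|lborel. f r) = (LINT r:{s..t}|lborel. g r)"
  unfolding set_integral_time[OF t]
proof (rule integral_cong_AE)
  have ind: "(indicator {..t} :: real \<Rightarrow> real) \<in> borel_measurable time"
    by (simp add: measurable_restrict_space1)
  show "(\<lambda>r. indicator {..t} r * f r) \<in> borel_measurable time"
    "(\<lambda>r. indicator {..t} r * g r) \<in> borel_measurable time"
    by (intro borel_measurable_times ind assms)+
  show "AE r in time. indicator {..t} r * f r = indicator {..t} r * g r"
    using assms(1) by eventually_elim simp
qed

text \<open>
  The accumulated control \<open>Y\<close> is known at time \<open>t\<close> because each \<open>u\<^sub>r\<close> with \<open>r \<le> t\<close> is.  As each of
  these has its own exceptional null set, the argument is a projection in \<open>L\<^sup>2\<close>: the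
  residual \<open>D = Y - E [Y | W]\<close> is orthogonal to everything known at time \<open>t\<close>, hence to each \<open>u\<^sub>r\<close>
  with \<open>r \<le> t\<close>, hence by Fubini's theorem to \<open>Y\<close>.  Being orthogonal to \<open>E [Y | W]\<close> as well, it
  is orthogonal to itself.
\<close>

lemma drift_cond_exp:
  assumes u: "observable_control u" and t: "t \<in> {s..T}"
  shows "AE \<omega> in M. real_cond_exp M (GW t) (drift u t) \<omega> = drift u t \<omega>"
proof -
  interpret G: finite_measure_subalgebra M "GW t"
    by unfold_locales (use subalgebra_GW t in auto)
  have u2: "square_integrable (time \<Otimes>\<^sub>M M) (\<lambda>(r, \<omega>). u r \<omega>)"
    using u by (simp add: observable_control_def)
  let ?Y = "drift u t" and ?Z = "real_cond_exp M (GW t) (drift u t)"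
  let ?D = "\<lambda>\<omega>. ?Y \<omega> - ?Z \<omega>"
  have Y: "square_integrable M ?Y" by (rule drift_square_integrable(1)[OF u2 t])
  have Z: "square_integrable M ?Z"
    by (rule G.real_cond_exp_square_integrable[OF square_integrable_integrable[OF Y] Y])
  have D: "square_integrable M ?D" by (rule square_integrable_diff[OF Y Z])
  (* the residual is orthogonal to everything known at time t *)
  have orth: "(\<integral>\<omega>. ?D \<omega> * h \<omega> \<partial>M) = 0"
    if h: "h \<in> borel_measurable (GW t)" "square_integrable M h" for h
  proof -
    have "(\<integral>\<omega>. h \<omega> * ?Z \<omega> \<partial>M) = (\<integral>\<omega>. h \<omega> * ?Y \<omega> \<partial>M)"
      by (rule G.real_cond_exp_intg(2)[OF square_integrable_mult[OF h(2) Y] h(1) square_integrable_measurable[OF Y]])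
    moreover have "(\<integral>\<omega>. ?D \<omega> * h \<omega> \<partial>M) = (\<integral>\<omega>. h \<omega> * ?Y \<omega> - h \<omega> * ?Z \<omega> \<partial>M)"
      by (simp add: algebra_simps)
    moreover have "\<dots> = (\<integral>\<omega>. h \<omega> * ?Y \<omega> \<partial>M) - (\<integral>\<omega>. h \<omega> * ?Z \<omega> \<partial>M)"
      by (rule Bochner_Integration.integral_diff[OF square_integrable_mult[OF h(2) Y] square_integrable_mult[OF h(2) Z]])
    ultimately show ?thesis by simp
  qed
  have Du: "integrable (time \<Otimes>\<^sub>M M) (\<lambda>(r, \<omega>). ?D \<omega> * u r \<omega>)"
    by (rule square_integrable_time_mult[OF square_integrable_const_time[OF D] u2])
  have "(\<integral>\<omega>. ?D \<omega> * ?Y \<omega> \<partial>M) = (\<integral>\<omega>. (LINT r:{s..t}|lborel. ?D \<omega> * u r \<omega>) \<partial>M)"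
    by (simp add: drift_def set_integral_mult_right)
  also have "\<dots> = (LINT r:{s..t}|lborel. (\<integral>\<omega>. ?D \<omega> * u r \<omega> \<partial>M))"
    by (rule expectation_time_integral(3)[OF Du t])
  also have "\<dots> = 0"
    unfolding set_integral_time[OF t]
  proof (rule integral_eq_zero_AE)
    show "AE r in time. indicator {..t} r * (\<integral>\<omega>. ?D \<omega> * u r \<omega> \<partial>M) = 0"
      using AE_observable_representative[OF u] AE_square_integrable[OF u2]
    proof eventually_elim
      case (elim r)
      then obtain h where h: "h \<in> borel_measurable (GW r)" "square_integrable M h"
        and uh: "AE \<omega> in M. u r \<omega> = h \<omega>" by blast
      show ?case
      proof (cases "r \<le> t")
        case True
        have "(\<integral>\<omega>. ?D \<omega> * u r \<omega> \<partial>M) = (\<integral>\<omega>. ?D \<omega> * h \<omega> \<partial>M)"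
        proof (rule integral_cong_AE)
          show "AE \<omega> in M. ?D \<omega> * u r \<omega> = ?D \<omega> * h \<omega>" using uh by eventually_elim simp
        qed (intro borel_measurable_times square_integrable_measurable[OF D]
               square_integrable_measurable[OF h(2)] square_integrable_measurable[OF elim(2)])+
        then show ?thesis using orth[OF measurable_GW_mono[OF h(1) True] h(2)] by simp
      qed simp
    qed
  qed
  finally have DY: "(\<integral>\<omega>. ?D \<omega> * ?Y \<omega> \<partial>M) = 0" .
  have DZ: "(\<integral>\<omega>. ?D \<omega> * ?Z \<omega> \<partial>M) = 0" by (rule orth[OF borel_measurable_cond_exp Z])
  have "(\<integral>\<omega>. (?D \<omega>)\<^sup>2 \<partial>M) = (\<integral>\<omega>. ?D \<omega> * ?Y \<omega> - ?D \<omega> * ?Z \<omega> \<partial>M)"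
    by (simp add: power2_eq_square right_diff_distrib)
  also have "\<dots> = 0"
    using DY DZ Bochner_Integration.integral_diff[OF square_integrable_mult[OF D Y] square_integrable_mult[OF D Z]]
    by simp
  finally have "AE \<omega> in M. (?D \<omega>)\<^sup>2 = 0"
    using integral_nonneg_eq_0_iff_AE[of M "\<lambda>\<omega>. (?D \<omega>)\<^sup>2"] D by (simp add: square_integrable_def)
  then show ?thesis by eventually_elim simp
qed

lemma state_decomposition:
  assumes t: "t \<in> {s..T}"
  shows "AE \<omega> in M. X u t \<omega> = observed u t \<omega> + hidden t \<omega>"
  using noise_AE[OF t]
  by eventually_elim (simp add: state_def observed_def hidden_def drift_def)

lemma hidden_moments:
  assumes t: "t \<in> {s..T}"
  shows "square_integrable M (hidden t)" "(\<integral>\<omega>. hidden t \<omega> \<partial>M) = 0"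
    "(\<integral>\<omega>. (hidden t \<omega>)\<^sup>2 \<partial>M) = \<eta>\<^sub>V\<^sup>2 * s + \<sigma>\<^sub>V\<^sup>2 * (t - s)"
  using brownian_motion_combination[OF bm_V, of s t 0 \<eta>\<^sub>V \<sigma>\<^sub>V] s_bounds t
  by (simp_all add: hidden_def[abs_def])

lemma hidden_independent:
  assumes t: "t \<in> {s..T}" and Z: "Z \<in> borel_measurable (GW T)" "integrable M Z"
  shows "(\<integral>\<omega>. Z \<omega> * hidden t \<omega> \<partial>M) = 0"
proof -
  have ind: "indep_set (sets (GW T)) (sets (GV T))"
    using basis by (simp add: two_brownian_basis_def)
  have [measurable]: "V s \<in> borel_measurable (GV T)" "V t \<in> borel_measurable (GV T)"
    using s_bounds t by (auto intro!: measurable_generated_filtration)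
  have "hidden t \<in> borel_measurable (GV T)" unfolding hidden_def by measurable
  from indep_sigma_algebras_integral_mult(2)[OF ind _ _ Z this] show ?thesis
    using square_integrable_integrable[OF hidden_moments(1)[OF t]] hidden_moments(2)[OF t] by simp
qed

lemma hidden_cond_exp:
  assumes t: "t \<in> {s..T}"
  shows "AE \<omega> in M. real_cond_exp M (GW t) (hidden t) \<omega> = 0"
proof -
  interpret G: finite_measure_subalgebra M "GW t"
    by unfold_locales (use subalgebra_GW t in auto)
  show ?thesis
  proof (rule G.real_cond_exp_charact)
    fix A assume A: "A \<in> sets (GW t)"
    then have "A \<in> sets (GW T)" using generated_filtration_mono[of t T M W] t by auto
    moreover have "A \<in> sets M" using A subalgebra_GW[of t] t by (auto simp: subalgebra_def)
    ultimately have "(\<integral>\<omega>. indicator A \<omega> * hidden t \<omega> \<partial>M) = 0"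
      by (intro hidden_independent[OF t]) (auto simp: less_top[symmetric])
    then show "(\<integral>\<omega>\<in>A. hidden t \<omega> \<partial>M) = (\<integral>\<omega>\<in>A. 0 \<partial>M)"
      by (simp add: set_lebesgue_integral_def)
  qed (use square_integrable_integrable[OF hidden_moments(1)[OF t]] in auto)
qed

lemma observed_square_integrable:
  assumes u: "square_integrable (time \<Otimes>\<^sub>M M) (\<lambda>(r, \<omega>). u r \<omega>)"
  shows "\<And>t. t \<in> {s..T} \<Longrightarrow> square_integrable M (observed u t)"
    and "square_integrable (time \<Otimes>\<^sub>M M) (\<lambda>(r, \<omega>). observed u r \<omega>)"
  using square_integrable_add[OF noise_moments(1) drift_square_integrable(1)[OF u]]
    square_integrable_add[OF noise_square_integrable drift_square_integrable(2)[OF u]]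
  by (simp_all add: observed_def[abs_def] split_beta')

lemma state_measurable:
  assumes u: "square_integrable (time \<Otimes>\<^sub>M M) (\<lambda>(r, \<omega>). u r \<omega>)" and t: "t \<in> {s..T}"
  shows "X u t \<in> borel_measurable M"
proof -
  have [measurable]: "W s \<in> borel_measurable M" "W t \<in> borel_measurable M" "V s \<in> borel_measurable M"
      "V t \<in> borel_measurable M" "drift u t \<in> borel_measurable M"
    using bm_W bm_V s_bounds t square_integrable_measurable[OF drift_square_integrable(1)[OF u t]]
    by (auto simp: brownian_motion_def)
  have "X u t = (\<lambda>\<omega>. x + \<eta>\<^sub>W * W s \<omega> + \<eta>\<^sub>V * V s \<omega> + drift u t \<omega>
       + \<sigma>\<^sub>W * (W t \<omega> - W s \<omega>) + \<sigma>\<^sub>V * (V t \<omega> - V s \<omega>))"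
    by (simp add: state_def drift_def fun_eq_iff)
  then show ?thesis by simp
qed

lemma prediction_eq:
  assumes u: "observable_control u" and t: "t \<in> {s..T}"
  shows "AE \<omega> in M. prediction M W (X u) t \<omega> = observed u t \<omega>"
proof -
  interpret G: finite_measure_subalgebra M "GW t"
    by unfold_locales (use subalgebra_GW t in auto)
  have u2: "square_integrable (time \<Otimes>\<^sub>M M) (\<lambda>(r, \<omega>). u r \<omega>)"
    using u by (simp add: observable_control_def)
  have n: "integrable M (noise t)" and d: "integrable M (drift u t)" and h: "integrable M (hidden t)"
    by (intro square_integrable_integrable noise_moments[OF t] hidden_moments[OF t]
        drift_square_integrable(1)[OF u2 t])+
  have Xm: "X u t \<in> borel_measurable M" by (rule state_measurable[OF u2 t])
  have "AE \<omega> in M. real_cond_exp M (GW t) (X u t) \<omega> =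
      real_cond_exp M (GW t) (\<lambda>\<omega>. noise t \<omega> + (drift u t \<omega> + hidden t \<omega>)) \<omega>"
  proof (rule G.real_cond_exp_cong[OF _ Xm])
    show "AE \<omega> in M. X u t \<omega> = noise t \<omega> + (drift u t \<omega> + hidden t \<omega>)"
      using state_decomposition[OF t, of u] by eventually_elim (simp add: observed_def)
  qed (use n d h in measurable)
  moreover note G.real_cond_exp_add[OF n Bochner_Integration.integrable_add[OF d h]]
    G.real_cond_exp_add[OF d h] hidden_cond_exp[OF t] drift_cond_exp[OF u t]
    G.real_cond_exp_F_meas[OF n noise_measurable]
  ultimately show ?thesis
    using s_bounds t unfolding prediction_def observed_def by auto
qed

section \<open>Moments of the observed part\<close>

abbreviation "mean u t \<equiv> (\<integral>\<omega>. observed u t \<omega> \<partial>M)"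
abbreviation "second_moment u t \<equiv> (\<integral>\<omega>. (observed u t \<omega>)\<^sup>2 \<partial>M)"

lemma drift_start: "drift u s \<omega> = 0"
  by (simp add: drift_def set_integral_point)

lemma observed_start:
  "mean u s = x" "second_moment u s = x\<^sup>2 + \<eta>\<^sub>W\<^sup>2 * s"
  using noise_moments(2,3)[of s] s_bounds by (simp_all add: observed_def drift_start)

lemma primitive_on_mean:
  assumes u: "square_integrable (time \<Otimes>\<^sub>M M) (\<lambda>(r, \<omega>). u r \<omega>)"
  shows "primitive_on s T (mean u) (\<lambda>r. \<integral>\<omega>. u r \<omega> \<partial>M)"
  unfolding primitive_on_def
proof (intro conjI ballI)
  have ui: "integrable (time \<Otimes>\<^sub>M M) (\<lambda>(r, \<omega>). u r \<omega>)"
    by (rule time_M.square_integrable_integrable[OF u])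
  show "set_integrable lborel {s..T} (\<lambda>r. \<integral>\<omega>. u r \<omega> \<partial>M)"
    unfolding set_integrable_time using expectation_time_integral(1)[OF ui] s_bounds by auto
  fix t assume t: "t \<in> {s..T}"
  have "mean u t = (\<integral>\<omega>. noise t \<omega> \<partial>M) + (\<integral>\<omega>. drift u t \<omega> \<partial>M)"
    unfolding observed_def
    by (intro Bochner_Integration.integral_add square_integrable_integrable
        noise_moments(1)[OF t] drift_square_integrable(1)[OF u t])
  then show "mean u t = mean u s + (LINT r:{s..t}|lborel. (\<integral>\<omega>. u r \<omega> \<partial>M))"
    using expectation_time_integral(3)[OF ui t] noise_moments(2)[OF t] observed_start(1)
    by (simp add: drift_def)
qed

text \<open>
  As \<open>u\<^sub>r\<close> is known at time \<open>r\<close>, it is uncorrelated with the increment of \<open>W\<close> from \<open>r\<close> to \<open>t\<close>,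
  and the noise at \<open>t\<close> may be replaced by the noise at \<open>r\<close>.
\<close>

lemma noise_control_correlation:
  assumes u: "observable_control u" and t: "t \<in> {s..T}"
  shows "(\<integral>\<omega>. noise t \<omega> * drift u t \<omega> \<partial>M) = (LINT r:{s..t}|lborel. (\<integral>\<omega>. noise r \<omega> * u r \<omega> \<partial>M))"
proof -
  have u2: "square_integrable (time \<Otimes>\<^sub>M M) (\<lambda>(r, \<omega>). u r \<omega>)"
    using u by (simp add: observable_control_def)
  have nt: "square_integrable M (noise t)" by (rule noise_moments[OF t])
  have int: "integrable (time \<Otimes>\<^sub>M M) (\<lambda>(r, \<omega>). noise t \<omega> * u r \<omega>)"
    by (rule square_integrable_time_mult[OF square_integrable_const_time[OF nt] u2])
  have int': "integrable (time \<Otimes>\<^sub>M M) (\<lambda>(r, \<omega>). noise r \<omega> * u r \<omega>)"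
    by (rule square_integrable_time_mult[OF noise_square_integrable u2])
  have "(\<integral>\<omega>. noise t \<omega> * drift u t \<omega> \<partial>M) = (\<integral>\<omega>. (LINT r:{s..t}|lborel. noise t \<omega> * u r \<omega>) \<partial>M)"
    by (simp add: drift_def set_integral_mult_right)
  also have "\<dots> = (LINT r:{s..t}|lborel. (\<integral>\<omega>. noise t \<omega> * u r \<omega> \<partial>M))"
    by (rule expectation_time_integral(3)[OF int t])
  also have "\<dots> = (\<integral>r. indicator {..t} r * (\<integral>\<omega>. noise r \<omega> * u r \<omega> \<partial>M) \<partial>time)"
    unfolding set_integral_time[OF t]
  proof (rule integral_cong_AE)
    have ind: "(indicator {..t} :: real \<Rightarrow> real) \<in> borel_measurable time"
      by (simp add: measurable_restrict_space1)
    show "(\<lambda>r. indicator {..t} r * (\<integral>\<omega>. noise t \<omega> * u r \<omega> \<partial>M)) \<in> borel_measurable time"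
      "(\<lambda>r. indicator {..t} r * (\<integral>\<omega>. noise r \<omega> * u r \<omega> \<partial>M)) \<in> borel_measurable time"
      by (intro borel_measurable_times ind borel_measurable_integrable
          expectation_time_integral(1)[OF int t] expectation_time_integral(1)[OF int' t])+
    show "AE r in time. indicator {..t} r * (\<integral>\<omega>. noise t \<omega> * u r \<omega> \<partial>M) =
        indicator {..t} r * (\<integral>\<omega>. noise r \<omega> * u r \<omega> \<partial>M)"
      using AE_observable_representative[OF u] AE_square_integrable[OF u2] AE_space
    proof eventually_elim
      case (elim r)
      then obtain h where h: "h \<in> borel_measurable (GW r)" "square_integrable M h"
        and uh: "AE \<omega> in M. u r \<omega> = h \<omega>" by blast
      have r: "0 \<le> r" "s \<le> r" "r \<le> T" using elim(3) s_bounds by auto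
      show ?case
      proof (cases "r \<le> t")
        case True
        note hi = square_integrable_integrable[OF h(2)]
        have tT: "t \<le> T" using t by simp
        have nr: "square_integrable M (noise r)" using noise_moments(1)[of r] r by simp
        note nh = square_integrable_mult[OF nr h(2)]
        note inc = brownian_motion_increment_mult[OF bm_W r(1) True tT h(1) hi]
        have ae: "AE \<omega> in M. noise t \<omega> * u r \<omega> = noise r \<omega> * h \<omega> + \<sigma>\<^sub>W * (h \<omega> * (W t \<omega> - W r \<omega>))"
          using uh noise_increment[OF r(2) True]
        proof eventually_elim
          case (elim \<omega>)
          show ?case unfolding elim by (simp add: algebra_simps)
        qed
        have ae': "AE \<omega> in M. noise r \<omega> * u r \<omega> = noise r \<omega> * h \<omega>"
          using uh by eventually_elim simp
        have [measurable]: "noise t \<in> borel_measurable M" "u r \<in> borel_measurable M"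
          "noise r \<in> borel_measurable M" "h \<in> borel_measurable M"
          "W t \<in> borel_measurable M" "W r \<in> borel_measurable M"
          using square_integrable_measurable[OF nt] square_integrable_measurable[OF elim(2)]
            square_integrable_measurable[OF nr] square_integrable_measurable[OF h(2)]
            bm_W r True tT by (auto simp: brownian_motion_def)
        have "(\<integral>\<omega>. noise t \<omega> * u r \<omega> \<partial>M) =
            (\<integral>\<omega>. noise r \<omega> * h \<omega> + \<sigma>\<^sub>W * (h \<omega> * (W t \<omega> - W r \<omega>)) \<partial>M)"
          by (rule integral_cong_AE[OF _ _ ae]) measurable
        also have "\<dots> = (\<integral>\<omega>. noise r \<omega> * h \<omega> \<partial>M) + \<sigma>\<^sub>W * (\<integral>\<omega>. h \<omega> * (W t \<omega> - W r \<omega>) \<partial>M)"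
          using nh inc(1) by simp
        also have "\<dots> = (\<integral>\<omega>. noise r \<omega> * h \<omega> \<partial>M)" unfolding inc(2) by simp
        also have "\<dots> = (\<integral>\<omega>. noise r \<omega> * u r \<omega> \<partial>M)"
          by (rule integral_cong_AE[OF _ _ ae', symmetric]) measurable
        finally show ?thesis by simp
      qed simp
    qed
  qed
  finally show ?thesis unfolding set_integral_time[OF t] .
qed

text \<open>
  The product rule for the accumulated control, applied to each path.
\<close>

lemma drift_square_expectation:
  assumes u: "square_integrable (time \<Otimes>\<^sub>M M) (\<lambda>(r, \<omega>). u r \<omega>)" and t: "t \<in> {s..T}"
  shows "(\<integral>\<omega>. (drift u t \<omega>)\<^sup>2 \<partial>M) = 2 * (LINT r:{s..t}|lborel. (\<integral>\<omega>. u r \<omega> * drift u r \<omega> \<partial>M))"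
proof -
  have int: "integrable (time \<Otimes>\<^sub>M M) (\<lambda>(r, \<omega>). u r \<omega> * drift u r \<omega>)"
    by (rule square_integrable_time_mult[OF u drift_square_integrable(2)[OF u]])
  have ui: "integrable (time \<Otimes>\<^sub>M M) (\<lambda>(r, \<omega>). u r \<omega>)"
    by (rule time_M.square_integrable_integrable[OF u])
  have "AE \<omega> in M. (drift u t \<omega>)\<^sup>2 = 2 * (LINT r:{s..t}|lborel. u r \<omega> * drift u r \<omega>)"
    using AE_integrable_snd[OF ui]
  proof eventually_elim
    case (elim \<omega>)
    then have f: "set_integrable lborel {s..t} (\<lambda>r. u r \<omega>)"
      using set_integrable_initial[of s T "\<lambda>r. u r \<omega>" t] t by (simp add: set_integrable_time)
    show ?case
      using set_integral_triangle_product(2)[OF f f] by (simp add: drift_def power2_eq_square)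
  qed
  then have "(\<integral>\<omega>. (drift u t \<omega>)\<^sup>2 \<partial>M) = (\<integral>\<omega>. 2 * (LINT r:{s..t}|lborel. u r \<omega> * drift u r \<omega>) \<partial>M)"
    by (rule integral_cong_AE[rotated 2])
       (intro borel_measurable_power borel_measurable_times borel_measurable_const
         square_integrable_measurable[OF drift_square_integrable(1)[OF u t]]
         borel_measurable_integrable[OF expectation_time_integral(2)[OF int t]])+
  then show ?thesis using expectation_time_integral(3)[OF int t] by simp
qed

text \<open>
  This is what Ito's formula gives for the square of the observed state.  In the expansion of
  \<open>(noise + drift)\<^sup>2\<close> the variance of the noise grows at rate \<open>\<sigma>\<^sub>W\<^sup>2\<close>, and the cross term and the
  square of the drift contribute the two halves of \<open>2 E [u \<cdot> observed]\<close>.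
\<close>

lemma primitive_on_second_moment:
  assumes u: "observable_control u"
  shows "primitive_on s T (second_moment u) (\<lambda>r. \<sigma>\<^sub>W\<^sup>2 + 2 * (\<integral>\<omega>. u r \<omega> * observed u r \<omega> \<partial>M))"
  unfolding primitive_on_def
proof (intro conjI ballI)
  have u2: "square_integrable (time \<Otimes>\<^sub>M M) (\<lambda>(r, \<omega>). u r \<omega>)"
    using u by (simp add: observable_control_def)
  let ?K = "\<lambda>r. \<integral>\<omega>. u r \<omega> * observed u r \<omega> \<partial>M"
  let ?Kn = "\<lambda>r. \<integral>\<omega>. noise r \<omega> * u r \<omega> \<partial>M" and ?Kd = "\<lambda>r. \<integral>\<omega>. u r \<omega> * drift u r \<omega> \<partial>M"
  have sT: "s \<in> {s..T}" using s_bounds by simp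
  note i = square_integrable_time_mult[OF u2 observed_square_integrable(2)[OF u2]]
    and in' = square_integrable_time_mult[OF noise_square_integrable u2]
    and id = square_integrable_time_mult[OF u2 drift_square_integrable(2)[OF u2]]
  note K = expectation_time_integral(1)[OF i sT]
    and Kn = expectation_time_integral(1)[OF in' sT] and Kd = expectation_time_integral(1)[OF id sT]
  have KK: "AE r in time. ?K r = ?Kn r + ?Kd r"
    using AE_integrable_fst[OF in'] AE_integrable_fst[OF id]
    by eventually_elim (simp add: observed_def algebra_simps)
  have "integrable time (\<lambda>r. \<sigma>\<^sub>W\<^sup>2 + 2 * ?K r)"
    by (intro Bochner_Integration.integrable_add integrable_mult_right K time.integrable_const)
  then show "set_integrable lborel {s..T} (\<lambda>r. \<sigma>\<^sub>W\<^sup>2 + 2 * ?K r)"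
    by (simp add: set_integrable_time)
  fix t assume t: "t \<in> {s..T}"
  have st: "set_integrable lborel {s..t} f" if "integrable time f" for f :: "real \<Rightarrow> real"
    using that t set_integrable_initial[of s T f t] by (simp add: set_integrable_time)
  have n: "square_integrable M (noise t)" and d: "square_integrable M (drift u t)"
    by (intro noise_moments[OF t] drift_square_integrable(1)[OF u2 t])+
  have "second_moment u t = (\<integral>\<omega>. (noise t \<omega>)\<^sup>2 + (2 * (noise t \<omega> * drift u t \<omega>) + (drift u t \<omega>)\<^sup>2) \<partial>M)"
    by (simp add: observed_def power2_sum algebra_simps)
  also have "\<dots> = (\<integral>\<omega>. (noise t \<omega>)\<^sup>2 \<partial>M) + (2 * (\<integral>\<omega>. noise t \<omega> * drift u t \<omega> \<partial>M) + (\<integral>\<omega>. (drift u t \<omega>)\<^sup>2 \<partial>M))"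
    using n d square_integrable_mult[OF n d] by (simp add: square_integrable_def)
  also have "\<dots> = second_moment u s + (\<sigma>\<^sub>W\<^sup>2 * (t - s) +
      (2 * (LINT r:{s..t}|lborel. ?Kn r) + 2 * (LINT r:{s..t}|lborel. ?Kd r)))"
    unfolding noise_moments(3)[OF t] noise_control_correlation[OF u t]
      drift_square_expectation[OF u2 t] observed_start by simp
  also have "\<sigma>\<^sub>W\<^sup>2 * (t - s) + (2 * (LINT r:{s..t}|lborel. ?Kn r) + 2 * (LINT r:{s..t}|lborel. ?Kd r)) =
      (LINT r:{s..t}|lborel. \<sigma>\<^sub>W\<^sup>2 + 2 * (?Kn r + ?Kd r))"
  proof -
    have c: "set_integrable lborel {s..t} (\<lambda>r. \<sigma>\<^sub>W\<^sup>2)"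
      by (rule st) (rule time.integrable_const)
    have "(LINT r:{s..t}|lborel. \<sigma>\<^sub>W\<^sup>2 + 2 * (?Kn r + ?Kd r)) =
        (LINT r:{s..t}|lborel. \<sigma>\<^sub>W\<^sup>2) + 2 * (LINT r:{s..t}|lborel. ?Kn r + ?Kd r)"
      by (subst set_integral_add(2)[OF c set_integrable_mult_right[OF set_integral_add(1)[OF st[OF Kn] st[OF Kd]]]])
         (simp only: set_integral_mult_right)
    also have "(LINT r:{s..t}|lborel. \<sigma>\<^sub>W\<^sup>2) = \<sigma>\<^sub>W\<^sup>2 * (t - s)"
      using t by (simp add: set_lebesgue_integral_def)
    finally show ?thesis using set_integral_add(2)[OF st[OF Kn] st[OF Kd]] by simp
  qed
  also have "\<dots> = (LINT r:{s..t}|lborel. \<sigma>\<^sub>W\<^sup>2 + 2 * ?K r)"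
  proof (rule set_integral_time_cong[OF _ _ _ t])
    show "AE r in time. \<sigma>\<^sub>W\<^sup>2 + 2 * (?Kn r + ?Kd r) = \<sigma>\<^sub>W\<^sup>2 + 2 * ?K r"
      using KK by eventually_elim simp
  qed (intro borel_measurable_add borel_measurable_times borel_measurable_const
       borel_measurable_integrable K Kn Kd)+
  finally show "second_moment u t = second_moment u s + (LINT r:{s..t}|lborel. \<sigma>\<^sub>W\<^sup>2 + 2 * ?K r)" .
qed

lemma primitive_on_riccati:
  "primitive_on s T \<phi>\<^sub>1 (\<lambda>t. (\<phi>\<^sub>1 t)\<^sup>2)"
  "primitive_on s T \<phi>\<^sub>2 (\<lambda>t. (\<phi>\<^sub>2 t)\<^sup>2 + 2 * \<phi>\<^sub>1 t * \<phi>\<^sub>2 t)"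
  "primitive_on s T \<phi>\<^sub>3 (\<lambda>t. - \<sigma>\<^sub>W\<^sup>2 * \<phi>\<^sub>1 t)"
  and continuous_riccati: "continuous_on {0..T} \<phi>\<^sub>1" "continuous_on {0..T} \<phi>\<^sub>2"
  and terminal_riccati: "\<phi>\<^sub>1 T = D\<^sub>1" "\<phi>\<^sub>2 T = D\<^sub>2" "\<phi>\<^sub>3 T = 0"
proof -
  have d: "(\<phi>\<^sub>1 has_real_derivative (\<phi>\<^sub>1 t)\<^sup>2) (at t within {0..T})"
      "(\<phi>\<^sub>2 has_real_derivative (\<phi>\<^sub>2 t)\<^sup>2 + 2 * \<phi>\<^sub>1 t * \<phi>\<^sub>2 t) (at t within {0..T})"
      "(\<phi>\<^sub>3 has_real_derivative - \<sigma>\<^sub>W\<^sup>2 * \<phi>\<^sub>1 t) (at t within {0..T})" if "t \<in> {0..T}" for t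
    using riccati[unfolded riccati_solution_def, THEN conjunct1, THEN bspec, OF that] by simp_all
  show c: "continuous_on {0..T} \<phi>\<^sub>1" "continuous_on {0..T} \<phi>\<^sub>2"
    by (rule DERIV_continuous_on[OF d(1)], assumption) (rule DERIV_continuous_on[OF d(2)], assumption)
  have sub: "{s..T} \<subseteq> {0..T}" using s_bounds by auto
  note c' = c[THEN continuous_on_subset[OF _ sub]]
  have d1: "(\<phi>\<^sub>1 has_real_derivative (\<phi>\<^sub>1 t)\<^sup>2) (at t within {s..T})"
    and d2: "(\<phi>\<^sub>2 has_real_derivative (\<phi>\<^sub>2 t)\<^sup>2 + 2 * \<phi>\<^sub>1 t * \<phi>\<^sub>2 t) (at t within {s..T})"
    and d3: "(\<phi>\<^sub>3 has_real_derivative - \<sigma>\<^sub>W\<^sup>2 * \<phi>\<^sub>1 t) (at t within {s..T})" if "t \<in> {s..T}" for t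
    by (intro DERIV_subset[OF d(1) sub] DERIV_subset[OF d(2) sub] DERIV_subset[OF d(3) sub]
        subsetD[OF sub that])+
  show "primitive_on s T \<phi>\<^sub>1 (\<lambda>t. (\<phi>\<^sub>1 t)\<^sup>2)"
    by (rule primitive_on_derivative[OF d1]) (assumption | intro continuous_intros c')+
  show "primitive_on s T \<phi>\<^sub>2 (\<lambda>t. (\<phi>\<^sub>2 t)\<^sup>2 + 2 * \<phi>\<^sub>1 t * \<phi>\<^sub>2 t)"
    by (rule primitive_on_derivative[OF d2]) (assumption | intro continuous_intros c')+
  show "primitive_on s T \<phi>\<^sub>3 (\<lambda>t. - \<sigma>\<^sub>W\<^sup>2 * \<phi>\<^sub>1 t)"
    by (rule primitive_on_derivative[OF d3]) (assumption | intro continuous_intros c')+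
  show "\<phi>\<^sub>1 T = D\<^sub>1" "\<phi>\<^sub>2 T = D\<^sub>2" "\<phi>\<^sub>3 T = 0"
    using riccati by (simp_all add: riccati_solution_def)
qed

section \<open>Completion of the square\<close>

text \<open>
  The deviation of a control from the feedback law.
\<close>

definition gap :: "(real \<Rightarrow> 'a \<Rightarrow> real) \<Rightarrow> real \<Rightarrow> 'a \<Rightarrow> real" where
  "gap u r \<omega> = u r \<omega> + \<phi>\<^sub>1 r * observed u r \<omega> + \<phi>\<^sub>2 r * mean u r"

lemma square_integrable_continuous_mult:
  assumes g: "continuous_on {s..T} g" and f: "square_integrable (time \<Otimes>\<^sub>M M) (\<lambda>(r, \<omega>). f r \<omega>)"
  shows "square_integrable (time \<Otimes>\<^sub>M M) (\<lambda>(r, \<omega>). g r * f r \<omega>)"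
proof -
  have "bounded (g ` {s..T})" by (intro compact_imp_bounded compact_continuous_image g compact_Icc)
  then obtain B where B: "\<bar>g r\<bar> \<le> B" if "r \<in> {s..T}" for r
    unfolding bounded_iff by (metis imageI real_norm_def)
  have "g \<in> borel_measurable time"
    using borel_measurable_continuous_on_restrict[OF g]
    by (simp add: measurable_def space_restrict_space sets_restrict_space)
  from measurable_compose[OF measurable_fst this]
  have gm: "(\<lambda>z. g (fst z)) \<in> borel_measurable (time \<Otimes>\<^sub>M M)" .
  show ?thesis
    using square_integrable_bounded_mult[OF f gm, of B] B
    by (auto simp: space_pair_measure split_beta')
qed

lemma gap_square_integrable:
  assumes u: "square_integrable (time \<Otimes>\<^sub>M M) (\<lambda>(r, \<omega>). u r \<omega>)"
  shows "square_integrable (time \<Otimes>\<^sub>M M) (\<lambda>(r, \<omega>). gap u r \<omega>)"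
proof -
  have sub: "{s..T} \<subseteq> {0..T}" using s_bounds by auto
  note c = continuous_riccati[THEN continuous_on_subset[OF _ sub]]
  have "continuous_on {s..T} (\<lambda>r. \<phi>\<^sub>2 r * mean u r)"
    by (intro continuous_intros c primitive_on_imp_continuous[OF primitive_on_mean[OF u]])
  note c2 = square_integrable_continuous_mult[OF this square_integrable_const_time[OF square_integrable_const[of 1]]]
  note c1 = square_integrable_continuous_mult[OF c(1) observed_square_integrable(2)[OF u]]
  from square_integrable_add[OF square_integrable_add[OF u c1] c2]
  show ?thesis by (simp add: gap_def split_beta')
qed

text \<open>
  The coefficients of the second moment and of the squared mean are the right-hand sides of the
  Riccati equations for \<open>\<phi>\<^sub>1\<close> and \<open>\<phi>\<^sub>2\<close>.
\<close>

lemma gap_second_moment: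
  assumes u: "square_integrable M (u r)" and o: "square_integrable M (observed u r)"
  shows "(\<integral>\<omega>. (gap u r \<omega>)\<^sup>2 \<partial>M) =
     (\<integral>\<omega>. (u r \<omega>)\<^sup>2 \<partial>M) + (\<phi>\<^sub>1 r)\<^sup>2 * second_moment u r + ((\<phi>\<^sub>2 r)\<^sup>2 + 2 * \<phi>\<^sub>1 r * \<phi>\<^sub>2 r) * (mean u r)\<^sup>2
     + 2 * \<phi>\<^sub>1 r * (\<integral>\<omega>. u r \<omega> * observed u r \<omega> \<partial>M) + 2 * \<phi>\<^sub>2 r * mean u r * (\<integral>\<omega>. u r \<omega> \<partial>M)"
proof -
  let ?p = "\<phi>\<^sub>1 r" and ?q = "\<phi>\<^sub>2 r * mean u r"
  have i: "integrable M (\<lambda>\<omega>. (u r \<omega>)\<^sup>2)" "integrable M (\<lambda>\<omega>. (observed u r \<omega>)\<^sup>2)"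
    "integrable M (\<lambda>\<omega>. u r \<omega> * observed u r \<omega>)" "integrable M (u r)" "integrable M (observed u r)"
    using u o square_integrable_mult[OF u o] square_integrable_integrable[OF u] square_integrable_integrable[OF o]
    by (simp_all add: square_integrable_def)
  have "(\<integral>\<omega>. (gap u r \<omega>)\<^sup>2 \<partial>M) = (\<integral>\<omega>. (u r \<omega>)\<^sup>2 + (?p\<^sup>2 * (observed u r \<omega>)\<^sup>2 + (?q\<^sup>2 +
      (2 * ?p * (u r \<omega> * observed u r \<omega>) + (2 * ?q * u r \<omega> + 2 * ?p * ?q * observed u r \<omega>)))) \<partial>M)"
    by (intro Bochner_Integration.integral_cong refl) (simp add: gap_def power2_eq_square algebra_simps)
  also have "\<dots> = (\<integral>\<omega>. (u r \<omega>)\<^sup>2 \<partial>M) + (?p\<^sup>2 * second_moment u r + ((\<integral>\<omega>. ?q\<^sup>2 \<partial>M) +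
      (2 * ?p * (\<integral>\<omega>. u r \<omega> * observed u r \<omega> \<partial>M) + (2 * ?q * (\<integral>\<omega>. u r \<omega> \<partial>M) + 2 * ?p * ?q * mean u r))))"
    using i by (simp only: Bochner_Integration.integral_add Bochner_Integration.integrable_add
        integrable_mult_right Bochner_Integration.integral_mult_right_zero integrable_const)
  finally show ?thesis by (simp add: prob_space power2_eq_square algebra_simps)
qed

text \<open>
  The hidden part is centred and orthogonal to the observed part, so it adds only its own variance.
\<close>

lemma terminal_moments:
  assumes u: "observable_control u"
  shows "moment (law M (X u T)) 1 = mean u T"
    and "moment (law M (X u T)) 2 = second_moment u T + (\<eta>\<^sub>V\<^sup>2 * s + \<sigma>\<^sub>V\<^sup>2 * (T - s))"
proof -
  have T: "T \<in> {s..T}" using s_bounds by simp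
  have u2: "square_integrable (time \<Otimes>\<^sub>M M) (\<lambda>(r, \<omega>). u r \<omega>)"
    using u by (simp add: observable_control_def)
  let ?P = "observed u T" and ?H = "hidden T"
  have P: "square_integrable M ?P" by (rule observed_square_integrable(1)[OF u2 T])
  have H: "square_integrable M ?H" by (rule hidden_moments[OF T])
  have Pi: "integrable M ?P" and Hi: "integrable M ?H"
    by (intro square_integrable_integrable P H)+
  have [measurable]: "?P \<in> borel_measurable M" "?H \<in> borel_measurable M"
    by (intro square_integrable_measurable P H)+
  have Xm [measurable]: "X u T \<in> borel_measurable M"
    by (rule state_measurable[OF u2 T])
  have ae: "AE \<omega> in M. X u T \<omega> = ?P \<omega> + ?H \<omega>" by (rule state_decomposition[OF T])
  then have ae2: "AE \<omega> in M. (X u T \<omega>)\<^sup>2 = (?P \<omega> + ?H \<omega>)\<^sup>2" by eventually_elim simp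
  have "moment (law M (X u T)) 1 = (\<integral>\<omega>. X u T \<omega> \<partial>M)"
    by (simp add: moment_def law_def integral_distr)
  also have "\<dots> = (\<integral>\<omega>. ?P \<omega> + ?H \<omega> \<partial>M)" by (rule integral_cong_AE[OF _ _ ae]) measurable
  also have "\<dots> = mean u T" using Pi Hi hidden_moments(2)[OF T] by simp
  finally show "moment (law M (X u T)) 1 = mean u T" .
  (* independence of W and V concerns variables measurable for W, so the observed part is replaced
     by its almost surely equal conditional expectation *)
  have PH: "(\<integral>\<omega>. ?P \<omega> * ?H \<omega> \<partial>M) = 0"
  proof -
    have pm: "prediction M W (X u) T \<in> borel_measurable (GW T)"
      unfolding prediction_def by (rule borel_measurable_cond_exp)
    have pM [measurable]: "prediction M W (X u) T \<in> borel_measurable M" by (rule measurable_GW[OF pm]) simp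
    have ae: "AE \<omega> in M. prediction M W (X u) T \<omega> = ?P \<omega>" by (rule prediction_eq[OF u T])
    have "integrable M (prediction M W (X u) T)"
      using Pi by (rule integrable_cong_AE_imp) (use ae in \<open>auto simp: eq_commute\<close>)
    then have "(\<integral>\<omega>. prediction M W (X u) T \<omega> * ?H \<omega> \<partial>M) = 0"
      by (rule hidden_independent[OF T pm])
    moreover have "(\<integral>\<omega>. prediction M W (X u) T \<omega> * ?H \<omega> \<partial>M) = (\<integral>\<omega>. ?P \<omega> * ?H \<omega> \<partial>M)"
    proof (rule integral_cong_AE)
      show "AE \<omega> in M. prediction M W (X u) T \<omega> * ?H \<omega> = ?P \<omega> * ?H \<omega>"
        using ae by eventually_elim simp
    qed measurable
    ultimately show ?thesis by simp
  qed
  have "moment (law M (X u T)) 2 = (\<integral>\<omega>. (X u T \<omega>)\<^sup>2 \<partial>M)"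
    by (simp add: moment_def law_def integral_distr)
  also have "\<dots> = (\<integral>\<omega>. (?P \<omega> + ?H \<omega>)\<^sup>2 \<partial>M)" by (rule integral_cong_AE[OF _ _ ae2]) measurable
  also have "\<dots> = (\<integral>\<omega>. (?P \<omega>)\<^sup>2 + (2 * (?P \<omega> * ?H \<omega>) + (?H \<omega>)\<^sup>2) \<partial>M)"
    by (simp add: power2_sum algebra_simps)
  also have "\<dots> = second_moment u T + (2 * (\<integral>\<omega>. ?P \<omega> * ?H \<omega> \<partial>M) + (\<integral>\<omega>. (?H \<omega>)\<^sup>2 \<partial>M))"
    using P H square_integrable_mult[OF P H] by (simp add: square_integrable_def)
  finally show "moment (law M (X u T)) 2 = second_moment u T + (\<eta>\<^sub>V\<^sup>2 * s + \<sigma>\<^sub>V\<^sup>2 * (T - s))"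
    unfolding PH hidden_moments(3)[OF T] by simp
qed

definition optimal_value :: real where
  "optimal_value = \<phi>\<^sub>1 s * (x\<^sup>2 + \<eta>\<^sub>W\<^sup>2 * s) + \<phi>\<^sub>2 s * x\<^sup>2 + \<phi>\<^sub>3 s
              + D\<^sub>1 * (\<eta>\<^sub>V\<^sup>2 * s + \<sigma>\<^sub>V\<^sup>2 * (T - s))"

text \<open>
  The function \<open>\<phi>\<^sub>1 m + \<phi>\<^sub>2 e\<^sup>2 + \<phi>\<^sub>3\<close> of the second moment \<open>m\<close> and the mean \<open>e\<close> equals the
  terminal cost of the observed part at \<open>T\<close>, and at \<open>s\<close> it equals the optimal value without the
  variance term of the hidden part.  By the Riccati equations its density is the expected square of
  the gap minus that of the control.
\<close>

theorem cost_identity: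
  assumes u: "observable_control u"
  shows "cost M s T D\<^sub>1 D\<^sub>2 X u =
    optimal_value + (\<integral>r. (\<integral>\<omega>. (gap u r \<omega>)\<^sup>2 \<partial>M) \<partial>time)"
proof -
  have sT: "s \<in> {s..T}" and TT: "T \<in> {s..T}" using s_bounds by auto
  have u2: "square_integrable (time \<Otimes>\<^sub>M M) (\<lambda>(r, \<omega>). u r \<omega>)"
    using u by (simp add: observable_control_def)
  let ?m = "second_moment u" and ?e = "mean u"
  let ?U = "\<lambda>r. \<integral>\<omega>. u r \<omega> \<partial>M" and ?K = "\<lambda>r. \<integral>\<omega>. u r \<omega> * observed u r \<omega> \<partial>M"
  let ?E = "\<lambda>r. \<integral>\<omega>. (u r \<omega>)\<^sup>2 \<partial>M" and ?G = "\<lambda>r. \<integral>\<omega>. (gap u r \<omega>)\<^sup>2 \<partial>M"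
  let ?v = "\<lambda>t. \<phi>\<^sub>1 t * ?m t + \<phi>\<^sub>2 t * (?e t * ?e t) + \<phi>\<^sub>3 t"
  let ?v' = "\<lambda>t. ((\<phi>\<^sub>1 t)\<^sup>2 * ?m t + \<phi>\<^sub>1 t * (\<sigma>\<^sub>W\<^sup>2 + 2 * ?K t)) +
     (((\<phi>\<^sub>2 t)\<^sup>2 + 2 * \<phi>\<^sub>1 t * \<phi>\<^sub>2 t) * (?e t * ?e t) + \<phi>\<^sub>2 t * (?U t * ?e t + ?e t * ?U t)) +
     - \<sigma>\<^sub>W\<^sup>2 * \<phi>\<^sub>1 t"
  have prim: "primitive_on s T ?v ?v'"
    by (intro primitive_on_add primitive_on_mult primitive_on_riccati primitive_on_second_moment[OF u]
        primitive_on_mean[OF u2])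
  have v': "integrable time ?v'"
    using prim unfolding primitive_on_def set_integrable_time by blast
  have vT: "?v T = ?v s + (\<integral>r. ?v' r \<partial>time)"
    using prim TT unfolding primitive_on_def set_integral_time_T[symmetric] by blast
  have i: "integrable (time \<Otimes>\<^sub>M M) (\<lambda>(r, \<omega>). (u r \<omega>)\<^sup>2)"
    using square_integrable_time_mult[OF u2 u2] by (simp add: power2_eq_square)
  have g: "integrable (time \<Otimes>\<^sub>M M) (\<lambda>(r, \<omega>). (gap u r \<omega>)\<^sup>2)"
    using square_integrable_time_mult[OF gap_square_integrable[OF u2] gap_square_integrable[OF u2]]
    by (simp add: power2_eq_square)
  have E: "integrable time ?E" and G: "integrable time ?G"
    by (rule expectation_time_integral(1)[OF i sT] expectation_time_integral(1)[OF g sT])+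
  have "(\<integral>r. ?E r + ?v' r \<partial>time) = (\<integral>r. ?G r \<partial>time)"
  proof (rule integral_cong_AE)
    show "AE r in time. ?E r + ?v' r = ?G r"
      using AE_square_integrable[OF u2] AE_space
    proof eventually_elim
      case (elim r)
      then have "square_integrable M (observed u r)" using observed_square_integrable(1)[OF u2] by simp
      from gap_second_moment[OF elim(1) this] show ?case
        by (simp add: power2_eq_square algebra_simps)
    qed
  qed (intro borel_measurable_integrable Bochner_Integration.integrable_add E v' G)+
  moreover have "(\<integral>r. ?E r + ?v' r \<partial>time) = (\<integral>r. ?E r \<partial>time) + (\<integral>r. ?v' r \<partial>time)"
    by (rule Bochner_Integration.integral_add[OF E v'])
  moreover have "(\<integral>\<omega>. (LINT r:{s..T}|lborel. (u r \<omega>)\<^sup>2) \<partial>M) = (\<integral>r. ?E r \<partial>time)"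
    using expectation_time_integral(3)[OF i TT] by (simp add: set_integral_time_T)
  ultimately have "cost M s T D\<^sub>1 D\<^sub>2 X u = ((\<integral>r. ?G r \<partial>time) - (\<integral>r. ?v' r \<partial>time)) +
      D\<^sub>1 * (?m T + (\<eta>\<^sub>V\<^sup>2 * s + \<sigma>\<^sub>V\<^sup>2 * (T - s))) + D\<^sub>2 * (?e T)\<^sup>2"
    unfolding cost_def terminal_moments[OF u] by linarith
  moreover have "?v T = D\<^sub>1 * ?m T + D\<^sub>2 * (?e T)\<^sup>2"
    by (simp add: terminal_riccati power2_eq_square)
  moreover have "?v s = \<phi>\<^sub>1 s * (x\<^sup>2 + \<eta>\<^sub>W\<^sup>2 * s) + \<phi>\<^sub>2 s * x\<^sup>2 + \<phi>\<^sub>3 s"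
    unfolding observed_start by (simp add: power2_eq_square)
  ultimately show ?thesis
    using vT unfolding optimal_value_def distrib_left[of D\<^sub>1] by linarith
qed

lemma cost_minimal_iff:
  assumes u: "observable_control u"
  shows "optimal_value \<le> cost M s T D\<^sub>1 D\<^sub>2 X u"
    and "cost M s T D\<^sub>1 D\<^sub>2 X u = optimal_value \<longleftrightarrow> (AE r in time. AE \<omega> in M. gap u r \<omega> = 0)"
proof -
  have sT: "s \<in> {s..T}" using s_bounds by auto
  have u2: "square_integrable (time \<Otimes>\<^sub>M M) (\<lambda>(r, \<omega>). u r \<omega>)"
    using u by (simp add: observable_control_def)
  note gap = gap_square_integrable[OF u2]
  have g: "integrable (time \<Otimes>\<^sub>M M) (\<lambda>(r, \<omega>). (gap u r \<omega>)\<^sup>2)"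
    using square_integrable_time_mult[OF gap gap] by (simp add: power2_eq_square)
  show "optimal_value \<le> cost M s T D\<^sub>1 D\<^sub>2 X u"
    unfolding cost_identity[OF u] by simp
  have "cost M s T D\<^sub>1 D\<^sub>2 X u = optimal_value \<longleftrightarrow> (\<integral>r. (\<integral>\<omega>. (gap u r \<omega>)\<^sup>2 \<partial>M) \<partial>time) = 0"
    unfolding cost_identity[OF u] by simp
  also have "\<dots> \<longleftrightarrow> (AE r in time. (\<integral>\<omega>. (gap u r \<omega>)\<^sup>2 \<partial>M) = 0)"
    by (rule integral_nonneg_eq_0_iff_AE[OF expectation_time_integral(1)[OF g sT]]) simp
  also have "\<dots> \<longleftrightarrow> (AE r in time. AE \<omega> in M. gap u r \<omega> = 0)"
  proof -
    have "AE r in time. (\<integral>\<omega>. (gap u r \<omega>)\<^sup>2 \<partial>M) = 0 \<longleftrightarrow> (AE \<omega> in M. gap u r \<omega> = 0)"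
      using AE_square_integrable[OF gap]
    proof eventually_elim
      case (elim r)
      then have "integrable M (\<lambda>\<omega>. (gap u r \<omega>)\<^sup>2)" by (simp add: square_integrable_def)
      from integral_nonneg_eq_0_iff_AE[OF this] show ?case by simp
    qed
    then show ?thesis by (auto elim: AE_mp)
  qed
  finally show "cost M s T D\<^sub>1 D\<^sub>2 X u = optimal_value \<longleftrightarrow> (AE r in time. AE \<omega> in M. gap u r \<omega> = 0)" .
qed

section \<open>A control following the feedback law\<close>

text \<open>
  The optimal control depends on the mean of the state that it produces.  Taking expectations in the
  feedback law shows that this mean must solve \<open>m' = - (\<phi>\<^sub>1 + \<phi>\<^sub>2) m\<close> with \<open>m(s) = x\<close>, and the
  solution is \<open>target_mean\<close>.  With this function in place of the mean, the feedback law becomes the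
  equation \<open>Y' = forcing - \<phi>\<^sub>1 Y\<close> for the accumulated control, which \<open>response\<close> solves on each path
  by variation of constants; \<open>exp \<circ> growth\<close> is the integrating factor.
\<close>

definition growth :: "real \<Rightarrow> real" where
  "growth t = (LINT r:{s..t}|lborel. \<phi>\<^sub>1 r)"

definition target_mean :: "real \<Rightarrow> real" where
  "target_mean t = x * exp (- (LINT r:{s..t}|lborel. \<phi>\<^sub>1 r + \<phi>\<^sub>2 r))"

definition forcing :: "real \<Rightarrow> 'a \<Rightarrow> real" where
  "forcing t \<omega> = - \<phi>\<^sub>1 t * noise t \<omega> - \<phi>\<^sub>2 t * target_mean t"

definition response :: "real \<Rightarrow> 'a \<Rightarrow> real" where
  "response t \<omega> = exp (- growth t) * drift (\<lambda>r \<omega>. exp (growth r) * forcing r \<omega>) t \<omega>"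

text \<open>
  The value zero before \<open>s\<close> reduces square integrability over \<open>{0..T}\<close> to that over \<open>{s..T}\<close>.
\<close>

definition feedback :: "real \<Rightarrow> 'a \<Rightarrow> real" where
  "feedback t \<omega> = (if s \<le> t then forcing t \<omega> - \<phi>\<^sub>1 t * response t \<omega> else 0)"

lemma continuous_on_from_start:
  assumes "continuous_on {s..T} g" and "\<And>t. t < s \<Longrightarrow> g t = g s"
  shows "continuous_on {0..T} (g :: real \<Rightarrow> real)"
proof -
  have "continuous_on {0..T} (\<lambda>t. g (max s t))"
    by (rule continuous_on_compose2[OF assms(1)]) (use s_bounds in \<open>auto intro!: continuous_intros\<close>)
  then show ?thesis
    by (rule continuous_on_eq) (metis assms(2) max_def linorder_not_less order_less_imp_le)
qed

lemma continuous_set_integral_from_start: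
  fixes f :: "real \<Rightarrow> real"
  assumes "continuous_on {s..T} f"
  shows "continuous_on {0..T} (\<lambda>t. LINT r:{s..t}|lborel. f r)"
  by (rule continuous_on_from_start[OF continuous_on_set_integral[OF assms]])
     (simp add: set_integral_point, simp add: set_lebesgue_integral_def)

lemma continuous_riccati_s: "continuous_on {s..T} \<phi>\<^sub>1" "continuous_on {s..T} \<phi>\<^sub>2"
  using continuous_riccati s_bounds by (auto elim: continuous_on_subset)

lemma continuous_growth: "continuous_on {0..T} growth"
  unfolding growth_def by (rule continuous_set_integral_from_start[OF continuous_riccati_s(1)])

lemma continuous_target_mean: "continuous_on {0..T} target_mean"
  unfolding target_mean_def
  by (intro continuous_intros continuous_set_integral_from_start continuous_riccati_s)

lemma forcing_continuous:
  "\<omega> \<in> space M \<Longrightarrow> continuous_on {0..T} (\<lambda>t. forcing t \<omega>)"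
  unfolding forcing_def
  by (intro continuous_intros continuous_riccati noise_continuous continuous_target_mean)

lemma response_continuous:
  assumes "\<omega> \<in> space M" shows "continuous_on {0..T} (\<lambda>t. response t \<omega>)"
  unfolding response_def drift_def
  by (intro continuous_intros continuous_growth continuous_set_integral_from_start
        continuous_on_subset[OF continuous_growth] continuous_on_subset[OF forcing_continuous[OF assms]])
     (use s_bounds in auto)

lemma forcing_measurable: "0 \<le> r \<Longrightarrow> r \<le> t \<Longrightarrow> forcing r \<in> borel_measurable (GW t)"
proof -
  assume "0 \<le> r" "r \<le> t"
  then have [measurable]: "noise r \<in> borel_measurable (GW t)"
    by (auto intro: measurable_GW_mono[OF noise_measurable])
  show "forcing r \<in> borel_measurable (GW t)" unfolding forcing_def by measurable
qed

lemma response_measurable: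
  assumes "0 \<le> r" "r \<le> t" "t \<le> T" shows "response r \<in> borel_measurable (GW t)"
proof -
  have "(\<lambda>\<omega>. LINT q:{s..r}|lborel. exp (growth q) * forcing q \<omega>) \<in> borel_measurable (GW t)"
  proof (rule pathwise_integral_measurable)
    fix q assume "q \<in> {0..r}"
    then have [measurable]: "forcing q \<in> borel_measurable (GW t)"
      using assms by (intro forcing_measurable) auto
    show "(\<lambda>\<omega>. exp (growth q) * forcing q \<omega>) \<in> borel_measurable (GW t)" by measurable
  next
    fix \<omega> assume "\<omega> \<in> space (GW t)"
    then have \<omega>: "\<omega> \<in> space M" by simp
    have "continuous_on {0..T} (\<lambda>q. exp (growth q) * forcing q \<omega>)"
      by (intro continuous_intros continuous_growth forcing_continuous \<omega>)
    then show "continuous_on {0..r} (\<lambda>q. exp (growth q) * forcing q \<omega>)"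
      by (rule continuous_on_subset) (use assms in auto)
  qed (use s_bounds in auto)
  then show ?thesis unfolding response_def drift_def by measurable
qed

lemma feedback_measurable:
  assumes "0 \<le> r" "r \<le> t" "t \<le> T" shows "feedback r \<in> borel_measurable (GW t)"
proof -
  note [measurable] = forcing_measurable[OF assms(1,2)] response_measurable[OF assms]
  show ?thesis unfolding feedback_def by measurable
qed

lemma feedback_progressive: "progressively_measurable M F T feedback"
  unfolding progressively_measurable_def
proof
  fix t assume t: "t \<in> {0..T}"
  let ?B = "restrict_space borel {0..t}" and ?g = "\<lambda>r \<omega>. forcing r \<omega> - \<phi>\<^sub>1 r * response r \<omega>"
  have FM: "space (F t) = space M"
    using basis t by (auto simp: two_brownian_basis_def usual_conditions_def subalgebra_def)
  have "sets (GW t) \<subseteq> sets (F t)"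
    using basis t unfolding two_brownian_basis_def by (auto intro: sigma_sets.Basic)
  then have "subalgebra (F t) (GW t)" using FM by (simp add: subalgebra_def)
  from measurable_from_subalg[OF this measurable_ident]
  have "(\<lambda>\<omega>. \<omega>) \<in> measurable (F t) (GW t)" by (simp add: id_def)
  then have id: "(\<lambda>z. (fst z, snd z)) \<in> measurable (?B \<Otimes>\<^sub>M F t) (?B \<Otimes>\<^sub>M GW t)"
    by (intro measurable_Pair measurable_fst measurable_compose[OF measurable_snd])
  have g: "(\<lambda>(r, \<omega>). ?g r \<omega>) \<in> borel_measurable (?B \<Otimes>\<^sub>M GW t)"
  proof (rule caratheodory_measurable)
    fix r assume "r \<in> {0..t}"
    then have r: "0 \<le> r" "r \<le> t" "t \<le> T" using t by auto
    note [measurable] = forcing_measurable[OF r(1,2)] response_measurable[OF r]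
    show "?g r \<in> borel_measurable (GW t)" by measurable
  next
    fix \<omega> assume "\<omega> \<in> space (GW t)"
    then have \<omega>: "\<omega> \<in> space M" by simp
    have "continuous_on {0..T} (\<lambda>r. ?g r \<omega>)"
      by (intro continuous_intros continuous_riccati forcing_continuous[OF \<omega>] response_continuous[OF \<omega>])
    then show "continuous_on {0..t} (\<lambda>r. ?g r \<omega>)"
      by (rule continuous_on_subset) (use t in auto)
  qed
  have [measurable]: "(\<lambda>z. ?g (fst z) (snd z)) \<in> borel_measurable (?B \<Otimes>\<^sub>M F t)"
    using measurable_compose[OF id g] by simp
  have "(\<lambda>r. r) \<in> borel_measurable ?B" by (simp add: measurable_restrict_space1)
  from measurable_compose[OF measurable_fst this]
  have [measurable]: "(\<lambda>z. fst z) \<in> borel_measurable (?B \<Otimes>\<^sub>M F t)" .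
  show "(\<lambda>(r, \<omega>). feedback r \<omega>) \<in> borel_measurable (?B \<Otimes>\<^sub>M F t)"
    unfolding feedback_def split_beta' by measurable
qed

lemma feedback_square_integrable: "square_integrable (time \<Otimes>\<^sub>M M) (\<lambda>(r, \<omega>). feedback r \<omega>)"
proof -
  have sub: "{s..T} \<subseteq> {0..T}" using s_bounds by auto
  note cg = continuous_on_subset[OF continuous_growth sub]
    and cm = continuous_on_subset[OF continuous_target_mean sub]
  have one: "square_integrable (time \<Otimes>\<^sub>M M) (\<lambda>(r, \<omega>). 1)"
    by (rule square_integrable_const_time[OF square_integrable_const])
  have c1: "continuous_on {s..T} (\<lambda>r. - \<phi>\<^sub>1 r)" and c2: "continuous_on {s..T} (\<lambda>r. \<phi>\<^sub>2 r * target_mean r)"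
    and c3: "continuous_on {s..T} (\<lambda>r. exp (growth r))" and c4: "continuous_on {s..T} (\<lambda>r. exp (- growth r))"
    by (intro continuous_intros continuous_riccati_s cg cm)+
  from square_integrable_diff[OF square_integrable_continuous_mult[OF c1 noise_square_integrable]
      square_integrable_continuous_mult[OF c2 one]]
  have f: "square_integrable (time \<Otimes>\<^sub>M M) (\<lambda>(r, \<omega>). forcing r \<omega>)"
    by (simp add: forcing_def split_beta')
  from square_integrable_continuous_mult[OF c4 drift_square_integrable(2)[OF square_integrable_continuous_mult[OF c3 f]]]
  have resp: "square_integrable (time \<Otimes>\<^sub>M M) (\<lambda>(r, \<omega>). response r \<omega>)"
    by (simp add: response_def)
  from square_integrable_add[OF f square_integrable_continuous_mult[OF c1 resp]]
  have g: "square_integrable (time \<Otimes>\<^sub>M M) (\<lambda>(r, \<omega>). forcing r \<omega> - \<phi>\<^sub>1 r * response r \<omega>)"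
    by (simp add: split_beta')
  have eq: "(case z of (r, \<omega>) \<Rightarrow> feedback r \<omega>) = (case z of (r, \<omega>) \<Rightarrow> forcing r \<omega> - \<phi>\<^sub>1 r * response r \<omega>)"
    if "z \<in> space (time \<Otimes>\<^sub>M M)" for z
    using that by (auto simp: space_pair_measure feedback_def)
  show ?thesis
    using g unfolding square_integrable_def
    by (simp add: eq cong: measurable_cong Bochner_Integration.integrable_cong)
qed

lemma L2_controls_square_integrable:
  assumes u: "u \<in> L2_controls M F T"
  shows "square_integrable (time \<Otimes>\<^sub>M M) (\<lambda>(r, \<omega>). u r \<omega>)"
  unfolding square_integrable_def
proof
  have "(\<lambda>(r, \<omega>). u r \<omega>) \<in> borel_measurable (restrict_space borel {0..T} \<Otimes>\<^sub>M F T)"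
    using u s_bounds by (simp add: L2_controls_def progressively_measurable_def)
  moreover have "sets (F T) = sets M" using basis by (simp add: two_brownian_basis_def)
  ultimately show um [measurable]: "(\<lambda>(r, \<omega>). u r \<omega>) \<in> borel_measurable (time \<Otimes>\<^sub>M M)"
    by (rule measurable_timeI)
  have "(\<integral>\<^sup>+z. ennreal (norm ((case z of (r, \<omega>) \<Rightarrow> u r \<omega>)\<^sup>2)) \<partial>(time \<Otimes>\<^sub>M M)) =
      (\<integral>\<^sup>+\<omega>. (\<integral>\<^sup>+r. ennreal ((u r \<omega>)\<^sup>2) \<partial>time) \<partial>M)"
    by (subst nn_integral_snd[symmetric]) (simp_all add: split_beta')
  also have "\<dots> \<le> (\<integral>\<^sup>+\<omega>. (\<integral>\<^sup>+r\<in>{0..T}. ennreal ((u r \<omega>)\<^sup>2) \<partial>lborel) \<partial>M)"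
    by (intro nn_integral_mono)
       (simp add: nn_integral_restrict_space, intro nn_integral_mono mult_left_mono,
        use s_bounds in \<open>auto simp: indicator_def\<close>)
  also have "\<dots> < \<infinity>" using u by (simp add: L2_controls_def)
  finally show "integrable (time \<Otimes>\<^sub>M M) (\<lambda>z. (case z of (r, \<omega>) \<Rightarrow> u r \<omega>)\<^sup>2)"
    by (intro integrableI_bounded) (use um in measurable)
qed

lemma feedback_L2_control: "feedback \<in> L2_controls M F T"
proof -
  have fm: "(\<lambda>(r, \<omega>). feedback r \<omega>) \<in> borel_measurable (time \<Otimes>\<^sub>M M)"
    by (rule square_integrable_measurable[OF feedback_square_integrable])
  have "(\<integral>\<^sup>+\<omega>. (\<integral>\<^sup>+r\<in>{0..T}. ennreal ((feedback r \<omega>)\<^sup>2) \<partial>lborel) \<partial>M) =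
      (\<integral>\<^sup>+\<omega>. (\<integral>\<^sup>+r. ennreal ((feedback r \<omega>)\<^sup>2) \<partial>time) \<partial>M)"
    using s_bounds
    by (intro nn_integral_cong)
       (simp add: nn_integral_restrict_space, intro nn_integral_cong, auto simp: indicator_def feedback_def)
  also have "\<dots> = (\<integral>\<^sup>+z. ennreal (norm ((case z of (r, \<omega>) \<Rightarrow> feedback r \<omega>)\<^sup>2)) \<partial>(time \<Otimes>\<^sub>M M))"
    by (subst nn_integral_snd[symmetric]) (use fm in \<open>simp_all add: split_beta'\<close>)
  also have "\<dots> < \<infinity>"
    using feedback_square_integrable by (simp add: square_integrable_def integrable_iff_bounded)
  finally show ?thesis using feedback_progressive by (simp add: L2_controls_def)
qed

lemma feedback_observable: "observable_control feedback"
  unfolding observable_control_def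
proof (intro conjI ballI feedback_square_integrable)
  fix r assume "r \<in> {s..T}"
  then have "feedback r \<in> borel_measurable (GW r)"
    using s_bounds by (intro feedback_measurable) auto
  then show "\<exists>h\<in>borel_measurable (GW r). AE \<omega> in M. feedback r \<omega> = h \<omega>" by auto
qed

text \<open>
  The response was chosen as the solution of the equation that the accumulated control satisfies.
\<close>

lemma drift_feedback:
  assumes t: "t \<in> {s..T}" and \<omega>: "\<omega> \<in> space M"
  shows "drift feedback t \<omega> = response t \<omega>"
proof -
  have "continuous_on {s..T} (\<lambda>r. forcing r \<omega>)"
    by (rule continuous_on_subset[OF forcing_continuous[OF \<omega>]]) (use s_bounds in auto)
  from variation_of_constants[OF continuous_riccati_s(1) this t]
  have "response t \<omega> = (LINT r:{s..t}|lborel. forcing r \<omega> - \<phi>\<^sub>1 r * response r \<omega>)"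
    by (simp add: response_def drift_def growth_def)
  also have "\<dots> = drift feedback t \<omega>"
    unfolding drift_def by (rule set_lebesgue_integral_cong) (auto simp: feedback_def)
  finally show ?thesis by simp
qed

lemma feedback_law:
  assumes t: "t \<in> {s..T}" and \<omega>: "\<omega> \<in> space M"
  shows "feedback t \<omega> = - \<phi>\<^sub>1 t * observed feedback t \<omega> - \<phi>\<^sub>2 t * target_mean t"
  using t unfolding observed_def drift_feedback[OF assms]
  by (simp add: feedback_def forcing_def algebra_simps)

text \<open>
  The mean that was inserted into the control is the one that the control produces: the difference
  \<open>d\<close> of the two satisfies \<open>d' = - \<phi>\<^sub>1 d\<close> and vanishes at \<open>s\<close>.
\<close>

lemma mean_feedback:
  assumes t: "t \<in> {s..T}"
  shows "mean feedback t = target_mean t"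
proof -
  let ?d = "\<lambda>t. mean feedback t + - 1 * target_mean t"
  have tm: "primitive_on s T target_mean (\<lambda>t. - (\<phi>\<^sub>1 t + \<phi>\<^sub>2 t) * target_mean t)"
  proof (rule primitive_on_derivative)
    let ?P = "\<lambda>t. LINT r:{s..t}|lborel. \<phi>\<^sub>1 r + \<phi>\<^sub>2 r"
    have c: "continuous_on {s..T} (\<lambda>r. \<phi>\<^sub>1 r + \<phi>\<^sub>2 r)" by (intro continuous_intros continuous_riccati_s)
    show "(target_mean has_real_derivative - (\<phi>\<^sub>1 r + \<phi>\<^sub>2 r) * target_mean r) (at r within {s..T})"
      if "r \<in> {s..T}" for r
    proof -
      have "(?P has_real_derivative \<phi>\<^sub>1 r + \<phi>\<^sub>2 r) (at r within {s..T})"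
        using set_integral_has_real_derivative[OF c, of ?P 0 r] that by simp
      then show ?thesis unfolding target_mean_def
        by (auto intro!: derivative_eq_intros simp: algebra_simps)
    qed
    show "continuous_on {s..T} (\<lambda>t. - (\<phi>\<^sub>1 t + \<phi>\<^sub>2 t) * target_mean t)"
      by (intro continuous_intros continuous_riccati_s continuous_on_subset[OF continuous_target_mean])
         (use s_bounds in auto)
  qed
  have E: "(\<integral>\<omega>. feedback r \<omega> \<partial>M) = - \<phi>\<^sub>1 r * mean feedback r - \<phi>\<^sub>2 r * target_mean r"
    if r: "r \<in> {s..T}" for r
  proof -
    have "integrable M (observed feedback r)"
      by (intro square_integrable_integrable observed_square_integrable(1)[OF feedback_square_integrable r])
    moreover have "(\<integral>\<omega>. feedback r \<omega> \<partial>M) = (\<integral>\<omega>. - \<phi>\<^sub>1 r * observed feedback r \<omega> - \<phi>\<^sub>2 r * target_mean r \<partial>M)"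
      by (intro Bochner_Integration.integral_cong refl feedback_law[OF r])
    ultimately show ?thesis by (simp add: prob_space)
  qed
  have d: "primitive_on s T ?d (\<lambda>t. (\<integral>\<omega>. feedback t \<omega> \<partial>M) + - 1 * (- (\<phi>\<^sub>1 t + \<phi>\<^sub>2 t) * target_mean t))"
    by (intro primitive_on_add primitive_on_const_mult primitive_on_mean feedback_square_integrable tm)
  have "primitive_on s T ?d (\<lambda>t. - \<phi>\<^sub>1 t * ?d t)"
  proof (rule primitive_on_cong[OF d])
    show "(\<integral>\<omega>. feedback t \<omega> \<partial>M) + - 1 * (- (\<phi>\<^sub>1 t + \<phi>\<^sub>2 t) * target_mean t) = - \<phi>\<^sub>1 t * ?d t"
      if "t \<in> {s..T}" for t
      unfolding E[OF that] by (simp add: algebra_simps)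
  qed
  from linear_ode_unique[OF continuous_riccati_s(1) this _ t]
  have "?d t = 0" by (simp add: observed_start target_mean_def set_integral_point)
  then show ?thesis by simp
qed

lemma gap_feedback:
  assumes "t \<in> {s..T}" "\<omega> \<in> space M"
  shows "gap feedback t \<omega> = 0"
  using feedback_law[OF assms] unfolding gap_def mean_feedback[OF assms(1)] by simp

lemma admissible_observable:
  assumes "u \<in> admissible_controls M F s T W X"
  shows "observable_control u"
proof -
  obtain a where a: "\<And>t \<mu>. a t \<mu> \<in> borel_measurable borel"
    and ua: "\<And>t. t \<in> {s..T} \<Longrightarrow> AE \<omega> in M. u t \<omega> = a t (law M (prediction M W (X u) t)) (prediction M W (X u) t \<omega>)"
    and u: "u \<in> L2_controls M F T"
    using assms unfolding admissible_controls_def by blast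
  have "\<exists>h\<in>borel_measurable (GW r). AE \<omega> in M. u r \<omega> = h \<omega>" if "r \<in> {s..T}" for r
  proof (rule bexI)
    show "AE \<omega> in M. u r \<omega> = a r (law M (prediction M W (X u) r)) (prediction M W (X u) r \<omega>)"
      by (rule ua[OF that])
    show "(\<lambda>\<omega>. a r (law M (prediction M W (X u) r)) (prediction M W (X u) r \<omega>)) \<in> borel_measurable (GW r)"
      by (rule measurable_compose[OF _ a]) (simp add: prediction_def)
  qed
  then show ?thesis
    using L2_controls_square_integrable[OF u] by (simp add: observable_control_def)
qed

text \<open>
  The target mean depends on time only, so the controller may read it off the clock instead of
  computing it from the law.
\<close>

lemma feedback_admissible: "feedback \<in> admissible_controls M F s T W X"
proof -
  let ?a = "\<lambda>t (\<mu> :: real measure) y. - \<phi>\<^sub>1 t * y - \<phi>\<^sub>2 t * target_mean t"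
  have "\<forall>t \<mu>. ?a t \<mu> \<in> borel_measurable borel" by simp
  moreover have "AE \<omega> in M. feedback t \<omega> = ?a t (law M (prediction M W (X feedback) t)) (prediction M W (X feedback) t \<omega>)"
    if "t \<in> {s..T}" for t
    using prediction_eq[OF feedback_observable that] AE_space
    by eventually_elim (simp add: feedback_law[OF that])
  ultimately have "\<exists>a. (\<forall>t \<mu>. a t \<mu> \<in> borel_measurable borel) \<and>
      (\<forall>t\<in>{s..T}. AE \<omega> in M. feedback t \<omega> =
        a t (law M (prediction M W (X feedback) t)) (prediction M W (X feedback) t \<omega>))"
    by (intro exI[of _ ?a]) simp
  then show ?thesis unfolding admissible_controls_def using feedback_L2_control by simp
qed

section \<open>Optimality\<close>

lemma feedback_law_iff_gap:
  assumes u: "observable_control u" and t: "t \<in> {s..T}"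
  shows "(AE \<omega> in M. u t \<omega> = - \<phi>\<^sub>1 t * prediction M W (X u) t \<omega>
            - \<phi>\<^sub>2 t * (LINT \<omega>'|M. prediction M W (X u) t \<omega>')) \<longleftrightarrow> (AE \<omega> in M. gap u t \<omega> = 0)"
proof -
  have u2: "square_integrable (time \<Otimes>\<^sub>M M) (\<lambda>(r, \<omega>). u r \<omega>)"
    using u by (simp add: observable_control_def)
  have [measurable]: "prediction M W (X u) t \<in> borel_measurable M"
    using t by (intro measurable_GW[of _ t]) (simp_all add: prediction_def)
  have [measurable]: "observed u t \<in> borel_measurable M"
    by (rule square_integrable_measurable[OF observed_square_integrable(1)[OF u2 t]])
  note ae = prediction_eq[OF u t]
  have m: "(LINT \<omega>'|M. prediction M W (X u) t \<omega>') = mean u t"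
    by (rule integral_cong_AE[OF _ _ ae]) measurable
  show ?thesis unfolding m
  proof
    assume "AE \<omega> in M. u t \<omega> = - \<phi>\<^sub>1 t * prediction M W (X u) t \<omega> - \<phi>\<^sub>2 t * mean u t"
    with ae show "AE \<omega> in M. gap u t \<omega> = 0" by eventually_elim (simp add: gap_def)
  next
    assume "AE \<omega> in M. gap u t \<omega> = 0"
    with ae show "AE \<omega> in M. u t \<omega> = - \<phi>\<^sub>1 t * prediction M W (X u) t \<omega> - \<phi>\<^sub>2 t * mean u t"
      by eventually_elim (simp add: gap_def algebra_simps)
  qed
qed

lemma AE_time_interior:
  "(AE r in time. P r) \<longleftrightarrow> (AE r in lborel. r \<in> {s<..<T} \<longrightarrow> P r)"
proof -
  have "AE r in lborel. r \<noteq> s \<and> r \<noteq> T"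
    using AE_lborel_singleton[of s] AE_lborel_singleton[of T] by eventually_elim simp
  then have "AE r in lborel. (r \<in> {s..T} \<longrightarrow> P r) \<longleftrightarrow> (r \<in> {s<..<T} \<longrightarrow> P r)"
    by eventually_elim auto
  then show ?thesis unfolding AE_time by (auto elim: AE_mp)
qed

lemma optimality:
  defines "U \<equiv> admissible_controls M F s T W X" and "J \<equiv> cost M s T D\<^sub>1 D\<^sub>2 X"
  defines "law_holds \<equiv> \<lambda>u t. AE \<omega> in M. u t \<omega> = - \<phi>\<^sub>1 t * prediction M W (X u) t \<omega>
            - \<phi>\<^sub>2 t * (LINT \<omega>'|M. prediction M W (X u) t \<omega>')"
  shows "optimal_in U J feedback" and "\<forall>t\<in>{s<..<T}. law_holds feedback t"
    and "\<forall>u\<in>U. optimal_in U J u \<longleftrightarrow> (AE t in lborel. t \<in> {s<..<T} \<longrightarrow> law_holds u t)"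
    and "(INF u\<in>U. J u) = optimal_value"
proof -
  have fU: "feedback \<in> U" unfolding U_def by (rule feedback_admissible)
  have obs: "observable_control u" if "u \<in> U" for u
    using that unfolding U_def by (rule admissible_observable)
  have ge: "optimal_value \<le> J u" if "u \<in> U" for u
    unfolding J_def by (rule cost_minimal_iff(1)[OF obs[OF that]])
  have "AE r in time. AE \<omega> in M. gap feedback r \<omega> = 0"
    by (intro AE_I2 gap_feedback) auto
  then have Jf: "J feedback = optimal_value"
    unfolding J_def using cost_minimal_iff(2)[OF feedback_observable] by blast
  show opt: "optimal_in U J feedback"
    unfolding optimal_in_def Jf using fU ge by blast
  show "\<forall>t\<in>{s<..<T}. law_holds feedback t"
  proof
    fix t assume "t \<in> {s<..<T}"
    then have t: "t \<in> {s..T}" by auto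
    show "law_holds feedback t"
      unfolding law_holds_def feedback_law_iff_gap[OF feedback_observable t]
      by (rule AE_I2) (rule gap_feedback[OF t])
  qed
  show "\<forall>u\<in>U. optimal_in U J u \<longleftrightarrow> (AE t in lborel. t \<in> {s<..<T} \<longrightarrow> law_holds u t)"
  proof
    fix u assume u: "u \<in> U"
    have "optimal_in U J u \<longleftrightarrow> J u = optimal_value"
      unfolding optimal_in_def using u fU Jf ge by (metis order.antisym)
    also have "\<dots> \<longleftrightarrow> (AE r in time. AE \<omega> in M. gap u r \<omega> = 0)"
      unfolding J_def by (rule cost_minimal_iff(2)[OF obs[OF u]])
    also have "\<dots> \<longleftrightarrow> (AE r in time. law_holds u r)"
      unfolding law_holds_def
      by (rule AE_cong, rule feedback_law_iff_gap[OF obs[OF u], symmetric]) simp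
    finally show "optimal_in U J u \<longleftrightarrow> (AE t in lborel. t \<in> {s<..<T} \<longrightarrow> law_holds u t)"
      unfolding AE_time_interior .
  qed
  show "(INF u\<in>U. J u) = optimal_value"
    by (rule cInf_eq_minimum) (use fU Jf ge in \<open>auto intro: image_eqI[of _ _ feedback]\<close>)
qed

end

theorem proposition5:
  fixes M :: "'a measure" and F :: "real \<Rightarrow> 'a measure"
    and W V :: "real \<Rightarrow> 'a \<Rightarrow> real"
    and T s x D\<^sub>1 D\<^sub>2 \<sigma>\<^sub>W \<sigma>\<^sub>V \<eta>\<^sub>W \<eta>\<^sub>V :: real
    and \<phi>\<^sub>1 \<phi>\<^sub>2 \<phi>\<^sub>3 :: "real \<Rightarrow> real"
    and X :: "(real \<Rightarrow> 'a \<Rightarrow> real) \<Rightarrow> real \<Rightarrow> 'a \<Rightarrow> real"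
    and Xhat :: "(real \<Rightarrow> 'a \<Rightarrow> real) \<Rightarrow> real \<Rightarrow> 'a \<Rightarrow> real"
    and U :: "(real \<Rightarrow> 'a \<Rightarrow> real) set"
    and J :: "(real \<Rightarrow> 'a \<Rightarrow> real) \<Rightarrow> real"
  assumes X_eq: "X = state s x \<eta>\<^sub>W \<eta>\<^sub>V \<sigma>\<^sub>W \<sigma>\<^sub>V W V"
    and Xhat_eq: "Xhat = (\<lambda>u. prediction M W (X u))"
    and U_eq: "U = admissible_controls M F s T W X"
    and J_eq: "J = cost M s T D\<^sub>1 D\<^sub>2 X"
  assumes T: "T > 0" and s: "s \<in> {0..T}"
    and basis: "two_brownian_basis M F T W V"
    and nonneg: "\<sigma>\<^sub>W \<ge> 0" "\<sigma>\<^sub>V \<ge> 0" "\<eta>\<^sub>W \<ge> 0" "\<eta>\<^sub>V \<ge> 0"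
    and sigma: "\<sigma>\<^sub>W\<^sup>2 + \<sigma>\<^sub>V\<^sup>2 = 1" and eta: "\<eta>\<^sub>W\<^sup>2 + \<eta>\<^sub>V\<^sup>2 = 1"
    and riccati: "riccati_solution T D\<^sub>1 D\<^sub>2 \<sigma>\<^sub>W \<phi>\<^sub>1 \<phi>\<^sub>2 \<phi>\<^sub>3"
  shows "(\<exists>u. optimal_in U J u \<and>
            (\<forall>t\<in>{s<..<T}. AE \<omega> in M.
               u t \<omega> = - \<phi>\<^sub>1 t * Xhat u t \<omega> - \<phi>\<^sub>2 t * (LINT \<omega>'|M. Xhat u t \<omega>')))
       \<and> (\<forall>u\<in>U. optimal_in U J u \<longleftrightarrow>
            (AE t in lborel. t \<in> {s<..<T} \<longrightarrow> (AE \<omega> in M.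
               u t \<omega> = - \<phi>\<^sub>1 t * Xhat u t \<omega> - \<phi>\<^sub>2 t * (LINT \<omega>'|M. Xhat u t \<omega>'))))
       \<and> (INF u\<in>U. J u)
            = \<phi>\<^sub>1 s * (x\<^sup>2 + \<eta>\<^sub>W\<^sup>2 * s) + \<phi>\<^sub>2 s * x\<^sup>2 + \<phi>\<^sub>3 s
              + D\<^sub>1 * (\<eta>\<^sub>V\<^sup>2 * s + \<sigma>\<^sub>V\<^sup>2 * (T - s))"
proof -
  have "AE \<omega> in M. continuous_on {0..T} (\<lambda>t. W t \<omega>)"
    using basis by (simp add: two_brownian_basis_def brownian_motion_def)
  then obtain N where "N \<in> null_sets M" "\<And>\<omega>. \<omega> \<in> space M - N \<Longrightarrow> continuous_on {0..T} (\<lambda>t. W t \<omega>)"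
    by (rule AE_E3) blast
  then interpret lq_control M F W V T s x D\<^sub>1 D\<^sub>2 \<sigma>\<^sub>W \<sigma>\<^sub>V \<eta>\<^sub>W \<eta>\<^sub>V \<phi>\<^sub>1 \<phi>\<^sub>2 \<phi>\<^sub>3 N
    using s basis riccati by unfold_locales
  show ?thesis
    unfolding J_eq U_eq Xhat_eq X_eq
    by (intro conjI exI[of _ feedback] optimality[unfolded optimal_value_def])
qed

end
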